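(* Consider the discretized two-slope ski rental problem with a single tail constraint $(\gamma,\delta)$ described in the context, and suppose the optimal value $\mathrm{OPT}$ is given. Then the greedy algorithm (run with this value of $\mathrm{OPT}$) terminates and returns an optimal solution, i.e. a feasible purchase distribution $f$ with $\sup_x \alpha_f(x)=\mathrm{OPT}$.
   Context: Fix $0\le a<1$ and a tail constraint $(\gamma,\delta)$ with $2-a\le\gamma<1/a$ and $0\le\delta\le1$. A purchase distribution $f$ is a probability distribution on the buying times; $f_t$ is the probability of switching from state 1 (cost $1$ per unit time) to state 2 (one-time cost $1-a$, then cost $a$ per unit time) at time $t$, and $f_\infty$ the probability of never switching. For buying time $t$ and adversary stopping time $x>0$ the ratio is $\alpha(t,x)=\frac{t+1-a+a(x-t)}{x}$ if $t\le x\le 1$; $\alpha(t,x)=1$ if $t>x$, $x\le1$; $\alpha(t,x)=\frac{t+1-a+a(x-t)}{1-a+ax}$ if $t\le x$, $x>1$; $\alpha(t,x)=\frac{x}{1-a+ax}$ if $t>x$, $x>1$ (including $t=\infty$); and $\alpha(t,\infty)=1$ for finite $t$, $\alpha(\infty,\infty)=1/a$. Let $\alpha_f(x)=\mathbb{E}_{t\sim f}[\alpha(t,x)]$. The bad interval of $x$ is $I_\gamma(x)=\{t:\alpha(t,x)>\gamma\}$; $f$ is feasible if $\sum_{t\in I_\gamma(x)}f_t\le\delta$ for every $x$. $\mathrm{OPT}$ is the minimum of $\sup_x\alpha_f(x)$ over feasible $f$, and an optimal solution is a feasible $f$ attaining it. Discretization: a sufficiently small step $\tau>0$ is fixed so that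 the points $L_3=\frac{1-a}{\gamma-1}$, $1$, $I_3=\frac{(\gamma-1)(1-a)}{1-a\gamma}$, $L_5=\frac{\gamma(1-a)}{1-a\gamma}$ and $L_b=\frac{\gamma-1}{1-a\gamma}$ are multiples of $\tau$; distributions are supported on $\{\tau,2\tau,\dots\}\cup\{\infty\}$ and all constraints are imposed at grid points $x$ (and $x=\infty$). Explicitly, for $L_3<x\le L_5$ with $x>1$ one has $I_\gamma(x)\cap\{t\le x\}$ an interval ending at $x$, and for $x>L_5$ the bad interval contains $(L_b,\infty]$. The greedy algorithm (given $\mathrm{OPT}$) sets: (i) $f_\tau=\min(\delta,\frac{\mathrm{OPT}-1}{1-a}\tau)$; (ii) for $x=2\tau,\dots,L_3$: $f_x=\min\{\delta-\sum_{t\in I_\gamma(x)\setminus\{x\}}f_t,\ \frac{x}{1-a}(\mathrm{OPT}-1)-\sum_{t<x}(1+t-x)f_t\}$; (iii) for $x=L_3+\tau,\dots,1$: $f_x=\frac{x}{1-a}(\mathrm{OPT}-1)-\sum_{t<x}(1+t-x)f_t$; (iv) if $\mathrm{OPT}=\frac{1+\tau}{1-a+a(1+\tau)}+\sum_{t\le1}\frac{(1-a)(t-\tau)}{1-a+a(1+\tau)}f_t$, set $f_\infty=\frac{\mathrm{OPT}-1}{1/a-1}$ and return $f$; (v) for $x=1+\tau,\dots,I_3$: let $m_x=\frac{1-a+ax}{1-a}\mathrm{OPT}-\frac{x}{1-a}-\sum_{t<x}(1+t-x)f_t$; if $1-\sum_{t<x}f_t\le m_x$ set $f_x=1-\sum_{t<x}f_t$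 and return, otherwise $f_x=m_x$; (vi) for $x=I_3+\tau,\dots,L_5$: same as (v) but with $m_x=\min\{\delta-\sum_{t\in I_\gamma(x)\setminus\{x\}}f_t,\ \frac{1-a+ax}{1-a}\mathrm{OPT}-\frac{x}{1-a}-\sum_{t<x}(1+t-x)f_t\}$; (vii) for $x\ge L_5+\tau$: same as (v) but with $m_x=\min\{\delta-\sum_{t=L_b+\tau}^{x-\tau}f_t,\ \frac{1-a+ax}{1-a}\mathrm{OPT}-\frac{x}{1-a}-\sum_{t<x}(1+t-x)f_t\}$.
   Formalization: For δ=0 the tail cap in step (ii) is not applied at x=L_3, which is treated as in step (iii); taken literally the claim fails there (a=0, γ=2, δ=0: the only feasible f is the point mass at 1, but the algorithm assigns 0 everywhere and never terminates). *)

theory Defs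
  imports "HOL-Probability.Probability"
begin

text \<open>
  Time is discretized with step \<open>\<tau>\<close>: an index \<open>n :: enat\<close> stands for the time \<open>n * \<tau>\<close>, and
  \<open>\<infinity>\<close> stands for ``never''.  Buying times and stopping times are the indices \<open>n \<ge> 1\<close>.
  The slope \<open>a = 0\<close> is allowed; then \<open>1/a\<close> means \<open>\<infinity>\<close>, which is what division in
  \<^typ>\<open>ennreal\<close> yields.  In \<^typ>\<open>real\<close> one has \<open>1/0 = 0\<close> instead, so there the case
  \<open>a = 0\<close> is treated separately.
\<close>

definition L3 :: "real \<Rightarrow> real \<Rightarrow> real" where
  "L3 a \<gamma> = (1 - a) / (\<gamma> - 1)"

definition I3 :: "real \<Rightarrow> real \<Rightarrow> real" where
  "I3 a \<gamma> = (\<gamma> - 1) * (1 - a) / (1 - a * \<gamma>)"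

definition L5 :: "real \<Rightarrow> real \<Rightarrow> real" where
  "L5 a \<gamma> = \<gamma> * (1 - a) / (1 - a * \<gamma>)"

definition Lb :: "real \<Rightarrow> real \<Rightarrow> real" where
  "Lb a \<gamma> = (\<gamma> - 1) / (1 - a * \<gamma>)"

definition on_grid :: "real \<Rightarrow> real \<Rightarrow> bool" where
  "on_grid \<tau> y \<longleftrightarrow> (\<exists>n::nat. y = real n * \<tau>)"

definition valid_step :: "real \<Rightarrow> real \<Rightarrow> real \<Rightarrow> bool" where
  "valid_step a \<gamma> \<tau> \<longleftrightarrow> 0 < \<tau> \<and> on_grid \<tau> (L3 a \<gamma>) \<and> on_grid \<tau> 1 \<and>
     on_grid \<tau> (I3 a \<gamma>) \<and> on_grid \<tau> (L5 a \<gamma>) \<and> on_grid \<tau> (Lb a \<gamma>)"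


section \<open>Ratios, feasibility and the optimal value\<close>

definition ratio_buy :: "real \<Rightarrow> real \<Rightarrow> real \<Rightarrow> real" where
  "ratio_buy a t x =
     (if t \<le> x then
        (if x \<le> 1 then (t + 1 - a + a * (x - t)) / x
         else (t + 1 - a + a * (x - t)) / (1 - a + a * x))
      else (if x \<le> 1 then 1 else x / (1 - a + a * x)))"

definition ratio_never :: "real \<Rightarrow> real \<Rightarrow> real" where
  "ratio_never a x = (if x \<le> 1 then 1 else x / (1 - a + a * x))"

definition ratio :: "real \<Rightarrow> real \<Rightarrow> enat \<Rightarrow> enat \<Rightarrow> ennreal" where
  "ratio a \<tau> t x =
     (case x of
        enat n \<Rightarrow> (case t of
            enat m \<Rightarrow> ennreal (ratio_buy a (real m * \<tau>) (real n * \<tau>))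
          | \<infinity> \<Rightarrow> ennreal (ratio_never a (real n * \<tau>)))
      | \<infinity> \<Rightarrow> (case t of enat m \<Rightarrow> 1 | \<infinity> \<Rightarrow> 1 / ennreal a))"

definition expected_ratio :: "real \<Rightarrow> real \<Rightarrow> enat pmf \<Rightarrow> enat \<Rightarrow> ennreal" where
  "expected_ratio a \<tau> f x = (\<integral>\<^sup>+ t. ratio a \<tau> t x \<partial>measure_pmf f)"

definition worst_ratio :: "real \<Rightarrow> real \<Rightarrow> enat pmf \<Rightarrow> ennreal" where
  "worst_ratio a \<tau> f = (SUP x\<in>{1..}. expected_ratio a \<tau> f x)"

definition bad :: "real \<Rightarrow> real \<Rightarrow> real \<Rightarrow> enat \<Rightarrow> enat set" where
  "bad a \<gamma> \<tau> x = {t. 1 \<le> t \<and> ratio a \<tau> t x > ennreal \<gamma>}"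

definition feasible :: "real \<Rightarrow> real \<Rightarrow> real \<Rightarrow> real \<Rightarrow> enat pmf \<Rightarrow> bool" where
  "feasible a \<gamma> \<delta> \<tau> f \<longleftrightarrow> set_pmf f \<subseteq> {1..} \<and>
     (\<forall>x\<ge>1. measure_pmf.prob f (bad a \<gamma> \<tau> x) \<le> \<delta>)"

definition opt_value :: "real \<Rightarrow> real \<Rightarrow> real \<Rightarrow> real \<Rightarrow> ennreal" where
  "opt_value a \<gamma> \<delta> \<tau> = (INF f\<in>{f. feasible a \<gamma> \<delta> \<tau> f}. worst_ratio a \<tau> f)"

definition optimal_solution :: "real \<Rightarrow> real \<Rightarrow> real \<Rightarrow> real \<Rightarrow> enat pmf \<Rightarrow> bool" where
  "optimal_solution a \<gamma> \<delta> \<tau> f \<longleftrightarrow>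
     feasible a \<gamma> \<delta> \<tau> f \<and> worst_ratio a \<tau> f = opt_value a \<gamma> \<delta> \<tau>"


section \<open>The greedy algorithm\<close>

text \<open>
  The state is the array \<open>f :: enat \<Rightarrow> real\<close> of masses assigned so far (all others are \<open>0\<close>);
  \<open>k\<close> is the index of the grid point \<open>x = k * \<tau>\<close> being processed, and \<open>P\<close> is the given
  optimal value.
\<close>

definition earlier :: "real \<Rightarrow> (enat \<Rightarrow> real) \<Rightarrow> nat \<Rightarrow> real" where
  "earlier \<tau> f k = (\<Sum>j\<in>{1..<k}. (1 + real j * \<tau> - real k * \<tau>) * f (enat j))"

text \<open>The largest masses at \<open>x\<close> for which the ratio at \<open>x\<close> stays at most \<open>P\<close>, for \<open>x \<le> 1\<close>
  and for \<open>x > 1\<close>.\<close>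

definition ratio_cap_early :: "real \<Rightarrow> real \<Rightarrow> real \<Rightarrow> (enat \<Rightarrow> real) \<Rightarrow> nat \<Rightarrow> real" where
  "ratio_cap_early a \<tau> P f k = real k * \<tau> / (1 - a) * (P - 1) - earlier \<tau> f k"

definition ratio_cap_late :: "real \<Rightarrow> real \<Rightarrow> real \<Rightarrow> (enat \<Rightarrow> real) \<Rightarrow> nat \<Rightarrow> real" where
  "ratio_cap_late a \<tau> P f k =
     (1 - a + a * (real k * \<tau>)) / (1 - a) * P - real k * \<tau> / (1 - a) - earlier \<tau> f k"

text \<open>This is used only for \<open>x \<le> L\<^sub>5\<close>, where no \<open>t > x\<close> is bad, so that the sum is finite.\<close>

definition tail_cap :: "real \<Rightarrow> real \<Rightarrow> real \<Rightarrow> real \<Rightarrow> (enat \<Rightarrow> real) \<Rightarrow> nat \<Rightarrow> real" where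
  "tail_cap a \<gamma> \<delta> \<tau> f k = \<delta> - (\<Sum>t\<in>bad a \<gamma> \<tau> (enat k) - {enat k}. f t)"

text \<open>
  Steps (i) to (iii).  The buying time \<open>L\<^sub>3\<close> is not bad for the stopping time \<open>L\<^sub>3\<close> (the ratio
  there equals \<open>\<gamma>\<close>), so the tail constraint does not bound the mass at \<open>L\<^sub>3\<close>.  For \<open>\<delta> > 0\<close>
  and small \<open>\<tau>\<close>, imposing the tail cap there anyway has no effect.  For \<open>\<delta> = 0\<close> it would
  force mass \<open>0\<close> at \<open>L\<^sub>3\<close>, and the algorithm would fail: for \<open>a = 0\<close>, \<open>\<gamma> = 2\<close>, the only
  feasible distribution is the point mass at \<open>L\<^sub>3 = 1\<close>.  So for \<open>\<delta> = 0\<close> the point \<open>L\<^sub>3\<close> is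
  treated like the points after it.
\<close>

definition head_mass :: "real \<Rightarrow> real \<Rightarrow> real \<Rightarrow> real \<Rightarrow> real \<Rightarrow> (enat \<Rightarrow> real) \<Rightarrow> nat \<Rightarrow> real" where
  "head_mass a \<gamma> \<delta> \<tau> P f k =
     (if k = 1 then min \<delta> ((P - 1) / (1 - a) * \<tau>)
      else if real k * \<tau> < L3 a \<gamma> \<or> (real k * \<tau> = L3 a \<gamma> \<and> \<delta> > 0)
        then min (tail_cap a \<gamma> \<delta> \<tau> f k) (ratio_cap_early a \<tau> P f k)
      else ratio_cap_early a \<tau> P f k)"

primrec head :: "real \<Rightarrow> real \<Rightarrow> real \<Rightarrow> real \<Rightarrow> real \<Rightarrow> nat \<Rightarrow> enat \<Rightarrow> real" where
  "head a \<gamma> \<delta> \<tau> P 0 = (\<lambda>_. 0)"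
| "head a \<gamma> \<delta> \<tau> P (Suc k) =
     (head a \<gamma> \<delta> \<tau> P k)
       (enat (Suc k) := head_mass a \<gamma> \<delta> \<tau> P (head a \<gamma> \<delta> \<tau> P k) (Suc k))"

text \<open>Steps (v) to (vii).\<close>

definition late_cap :: "real \<Rightarrow> real \<Rightarrow> real \<Rightarrow> real \<Rightarrow> real \<Rightarrow> (enat \<Rightarrow> real) \<Rightarrow> nat \<Rightarrow> real" where
  "late_cap a \<gamma> \<delta> \<tau> P f k =
     (if real k * \<tau> \<le> I3 a \<gamma> then ratio_cap_late a \<tau> P f k
      else if real k * \<tau> \<le> L5 a \<gamma>
        then min (tail_cap a \<gamma> \<delta> \<tau> f k) (ratio_cap_late a \<tau> P f k)
      else min (\<delta> - (\<Sum>j\<in>{j\<in>{1..<k}. Lb a \<gamma> < real j * \<tau>}. f (enat j)))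
               (ratio_cap_late a \<tau> P f k))"

text \<open>The loop returns \<^const>\<open>None\<close> exactly if it does not terminate.\<close>

partial_function (option) late_loop ::
  "real \<Rightarrow> real \<Rightarrow> real \<Rightarrow> real \<Rightarrow> real \<Rightarrow> nat \<Rightarrow> (enat \<Rightarrow> real) \<Rightarrow> (enat \<Rightarrow> real) option" where
  "late_loop a \<gamma> \<delta> \<tau> P k f =
     (let rest = 1 - (\<Sum>j\<in>{1..<k}. f (enat j));
          m = late_cap a \<gamma> \<delta> \<tau> P f k
      in if rest \<le> m then Some (f(enat k := rest))
         else late_loop a \<gamma> \<delta> \<tau> P (Suc k) (f(enat k := m)))"

text \<open>Below, \<open>N\<close> is the index of the time \<open>1\<close>, and the condition is that of step (iv).\<close>

definition greedy ::
  "real \<Rightarrow> real \<Rightarrow> real \<Rightarrow> real \<Rightarrow> real \<Rightarrow> (enat \<Rightarrow> real) option" where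
  "greedy a \<gamma> \<delta> \<tau> P =
     (let N = nat \<lfloor>1 / \<tau>\<rfloor>;
          f = head a \<gamma> \<delta> \<tau> P N
      in if P = (1 + \<tau>) / (1 - a + a * (1 + \<tau>)) +
               (\<Sum>j\<in>{1..N}. (1 - a) * (real j * \<tau> - \<tau>) / (1 - a + a * (1 + \<tau>)) * f (enat j))
         then Some (f(\<infinity> := (if a = 0 then 0 else (P - 1) / (1 / a - 1))))
         else late_loop a \<gamma> \<delta> \<tau> P (N + 1) f)"

end

(*
  In terms of the cumulative masses V k, the ratio constraint at a grid point reads
  V k <= c k + tau * (V 0 + ... + V (k - 1)), and the tail constraint reads
  V k <= delta + V (l k), where l k is the last point before the bad interval.  Both bounds are
  monotone in the earlier values, so the greedy masses have the largest cumulative function: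
  they dominate every feasible distribution with value at most OPT.

  Let kappa = (1 - a OPT) / (1 - a).  Beyond time 1 the ratio bound changes per step by
  tau * (V - kappa), so domination of some nonnegative V forces V >= kappa at time 1 for the greedy
  masses.  If V = kappa there, the bound stays constant and step (iv) applies.  If V > kappa, it
  grows linearly, and as every feasible distribution has mass at least 1 - delta up to L_b, the
  loop reaches total mass 1.  Mass more than 1 before time 1 is impossible: scaling it down to 1
  would give a value below OPT.
*)

theory Submission
  imports Defs
begin

subsection \<open>Bad sets on the grid\<close>

text \<open>After time 1 the greedy cumulative masses are monotone only if they are at least
  \<open>kappa P\<close> at time 1, and this bound comes only from domination. So domination is
  proved first, from the recurrences alone, without knowing that the late masses are nonnegative. To
  have the recurrences at every index, \<open>run\<close> never stops; its total mass may exceed 1,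
  and the cut is made only when the returned distribution is built. At L3, for
  \<open>\<delta> > 0\<close>, the algorithm imposes a cap that feasible distributions need not
  obey, so domination requires that this cap does not lower the mass. This, and L3 not being the
  first grid point, is all that a small step is needed for. The optimal value itself varies with the
  step, so the estimates have to be uniform in it; buying at L3 shows that it is at most
  \<open>\<gamma>\<close>, and this is the only upper bound on it that enters the choice of the
  step.\<close>

locale ski_grid =
  fixes a \<gamma> \<delta> \<tau> :: real and M N I L B :: nat
  assumes a_nonneg: "0 \<le> a" and a_less_1: "a < 1"
    and gamma_ge: "2 - a \<le> \<gamma>" and a_gamma: "a * \<gamma> < 1"
    and delta_nonneg: "0 \<le> \<delta>" and delta_le_1: "\<delta> \<le> 1" and tau_pos: "0 < \<tau>"
    and M_tau: "real M * \<tau> = L3 a \<gamma>" and N_tau: "real N * \<tau> = 1"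
    and I_tau: "real I * \<tau> = I3 a \<gamma>" and L_tau: "real L * \<tau> = L5 a \<gamma>"
    and B_tau: "real B * \<tau> = Lb a \<gamma>"
begin

text \<open>The bad interval of the \<open>k\<close>-th grid point starts right after this time (if it is nonempty).\<close>

definition low_time :: "nat \<Rightarrow> real" where
  "low_time k = (if k \<le> N then real k * \<tau> - 1 + real k * \<tau> * (\<gamma> - 1) / (1 - a)
                 else (\<gamma> - 1) * (1 - a + a * (real k * \<tau>)) / (1 - a))"

text \<open>\<open>low_time k\<close> is negative for small \<open>k\<close>; \<open>nat\<close>
  then yields 0, an index without mass, so that all of \<open>{1..k}\<close> counts as bad.\<close>

definition low :: "nat \<Rightarrow> nat" where
  "low k = nat \<lfloor>low_time k / \<tau>\<rfloor>"

lemma gamma_gt_1: "1 < \<gamma>"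
  using a_less_1 gamma_ge by linarith

lemma time_le_iff: "real j * \<tau> \<le> real k * \<tau> \<longleftrightarrow> j \<le> k"
  using tau_pos by simp

lemma time_less_iff: "real j * \<tau> < real k * \<tau> \<longleftrightarrow> j < k"
  using tau_pos by simp

lemma low_less_iff: "low k < j \<longleftrightarrow> 1 \<le> j \<and> low_time k < real j * \<tau>"
proof -
  have "low k < j \<longleftrightarrow> 1 \<le> j \<and> \<lfloor>low_time k / \<tau>\<rfloor> < int j"
    unfolding low_def by linarith
  also have "\<dots> \<longleftrightarrow> 1 \<le> j \<and> low_time k / \<tau> < real j"
    by (simp add: floor_less_iff)
  finally show ?thesis using tau_pos by (simp add: pos_divide_less_eq)
qed

lemma le_low_iff: "1 \<le> j \<Longrightarrow> j \<le> low k \<longleftrightarrow> real j * \<tau> \<le> low_time k"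
  using low_less_iff[of k j] by linarith

lemma low_mono_time: "low_time j \<le> low_time k \<Longrightarrow> low j \<le> low k"
  using tau_pos unfolding low_def by (intro nat_mono floor_mono divide_right_mono) auto

lemma N_pos: "0 < N"
  using N_tau by (cases N) auto

text \<open>The hypothesis \<open>2 - a \<le> \<gamma>\<close> is equivalent to L3 being at most 1,
  and also to I3 being at least 1.\<close>

lemma M_pos: "0 < M" and M_le_N: "M \<le> N"
proof -
  have "0 < real M * \<tau>" using M_tau gamma_gt_1 a_less_1 by (simp add: L3_def)
  then show "0 < M" by (cases M) auto
  have "real M * \<tau> \<le> real N * \<tau>"
    using M_tau N_tau gamma_gt_1 gamma_ge by (simp add: L3_def pos_divide_le_eq)
  then show "M \<le> N" by (simp add: time_le_iff)
qed

lemma N_le_I: "N \<le> I"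
proof -
  have "1 - a * \<gamma> \<le> (\<gamma> - 1) * (1 - a)"
    using gamma_ge by (simp add: algebra_simps)
  then have "real N * \<tau> \<le> real I * \<tau>"
    using I_tau N_tau a_gamma by (simp add: I3_def pos_le_divide_eq)
  then show ?thesis by (simp add: time_le_iff)
qed

lemma I_less_L: "I < L"
proof -
  have "real I * \<tau> < real L * \<tau>"
    using I_tau L_tau a_gamma a_less_1 by (simp add: I3_def L5_def divide_strict_right_mono)
  then show ?thesis by (simp add: time_less_iff)
qed

lemma L_eq: "L = B + N"
proof -
  have "\<gamma> * (1 - a) = (\<gamma> - 1) + (1 - a * \<gamma>)" by (simp add: algebra_simps)
  then have "L5 a \<gamma> = ((\<gamma> - 1) + (1 - a * \<gamma>)) / (1 - a * \<gamma>)"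
    by (simp only: L5_def)
  also have "\<dots> = Lb a \<gamma> + 1"
    using a_gamma by (simp only: Lb_def add_divide_distrib) simp
  finally have "L5 a \<gamma> = Lb a \<gamma> + 1" .
  then have "real L * \<tau> = real (B + N) * \<tau>"
    using L_tau N_tau B_tau by (simp add: distrib_right)
  then show ?thesis using tau_pos by simp
qed

section \<open>Position of the bad intervals relative to the named grid points\<close>

lemma low_time_ge_iff:
  assumes "k \<le> N" "0 < k"
  shows "real k * \<tau> \<le> low_time k \<longleftrightarrow> M \<le> k"
proof -
  have "M \<le> k \<longleftrightarrow> (1 - a) / (\<gamma> - 1) \<le> real k * \<tau>"
    using M_tau by (metis L3_def time_le_iff)
  also have "\<dots> \<longleftrightarrow> 1 - a \<le> real k * \<tau> * (\<gamma> - 1)"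
    using gamma_gt_1 by (simp add: pos_divide_le_eq)
  also have "\<dots> \<longleftrightarrow> 1 \<le> real k * \<tau> * (\<gamma> - 1) / (1 - a)"
    using a_less_1 by (simp add: pos_le_divide_eq)
  finally show ?thesis using assms by (simp add: low_time_def)
qed

lemma low_time_late_ge_iff:
  assumes "N < k"
  shows "real k * \<tau> \<le> low_time k \<longleftrightarrow> k \<le> I"
proof -
  have "real k * \<tau> \<le> low_time k \<longleftrightarrow> real k * \<tau> * (1 - a) \<le> (\<gamma> - 1) * (1 - a + a * (real k * \<tau>))"
    using assms a_less_1 by (simp add: low_time_def pos_le_divide_eq)
  also have "\<dots> \<longleftrightarrow> real k * \<tau> * (1 - a * \<gamma>) \<le> (\<gamma> - 1) * (1 - a)"
    by (simp add: algebra_simps)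
  also have "\<dots> \<longleftrightarrow> real k * \<tau> \<le> I3 a \<gamma>"
    using a_gamma by (simp add: I3_def pos_le_divide_eq)
  finally show ?thesis using I_tau by (metis time_le_iff)
qed

text \<open>Up to time 1 the difference \<open>low_time k - real k * \<tau>\<close> increases and
  vanishes at L3. Its formula after time 1 decreases, because \<open>a * \<gamma> < 1\<close>, and
  vanishes at I3. Hence the tail constraint is vacuous from \<open>M\<close> to
  \<open>I\<close>.\<close>

lemma low_less_self_iff:
  assumes "0 < k"
  shows "low k < k \<longleftrightarrow> k < M \<or> I < k"
proof (cases "k \<le> N")
  case True
  then show ?thesis using low_less_iff[of k k] low_time_ge_iff[of k] assms N_le_I M_le_N by linarith
next
  case False
  then show ?thesis using low_less_iff[of k k] low_time_late_ge_iff[of k] M_le_N assms by linarith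
qed

lemma low_mono_early: "j \<le> k \<Longrightarrow> k \<le> N \<Longrightarrow> low j \<le> low k"
  using tau_pos gamma_gt_1 a_less_1
  by (intro low_mono_time) (auto simp: low_time_def intro!: add_mono divide_right_mono mult_right_mono)

lemma low_mono_late: "N < j \<Longrightarrow> j \<le> k \<Longrightarrow> low j \<le> low k"
  using tau_pos gamma_gt_1 a_less_1 a_nonneg
  by (intro low_mono_time)
    (auto simp: low_time_def intro!: add_mono divide_right_mono mult_right_mono mult_left_mono)

lemma N_le_low:
  assumes "N < k"
  shows "N \<le> low k"
proof -
  have "1 - a \<le> (\<gamma> - 1) * 1" using gamma_ge by simp
  also have "(\<gamma> - 1) * (1 - a) + (\<gamma> - 1) * (a * 1) \<le> (\<gamma> - 1) * (1 - a + a * (real k * \<tau>))"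
  proof -
    have "1 \<le> real k * \<tau>" using assms N_tau by (metis less_imp_le time_le_iff)
    then have "(\<gamma> - 1) * (a * 1) \<le> (\<gamma> - 1) * (a * (real k * \<tau>))"
      using a_nonneg gamma_gt_1 by (intro mult_left_mono) auto
    then show ?thesis by (simp add: algebra_simps)
  qed
  then have "(\<gamma> - 1) * 1 \<le> (\<gamma> - 1) * (1 - a + a * (real k * \<tau>))" by (simp add: algebra_simps)
  finally have "real N * \<tau> \<le> low_time k"
    using assms a_less_1 N_tau by (simp add: low_time_def pos_le_divide_eq)
  then show ?thesis using le_low_iff[of N k] N_pos by simp
qed

text \<open>The bad interval of \<open>I\<close> is empty, and \<open>low\<close> is monotone after
  \<open>N\<close>. The monotonicity lemmas do not cross \<open>N\<close>, hence the separate case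
  \<open>I = N\<close>.\<close>

lemma I_le_low:
  assumes "I < k"
  shows "I \<le> low k"
proof (cases "I = N")
  case True
  then show ?thesis using N_le_low assms by simp
next
  case False
  then have "N < I" using N_le_I by simp
  then show ?thesis
    using low_less_self_iff[of I] low_mono_late[of I k] assms M_le_N by fastforce
qed

text \<open>For \<open>a > 0\<close> the bad interval keeps moving to the right after L5, whereas
  step (vii) always sums from Lb. The two agree at \<open>Suc L\<close>, the first point for which
  never buying is bad: by \<open>a * \<gamma> < 1\<close>, the start moves by less than one grid
  step per grid step.\<close>

lemma low_L: "low L = B" and low_Suc_L: "low (Suc L) = B"
proof -
  have NL: "N < L" using N_le_I I_less_L by simp
  have "1 - a + a * (real L * \<tau>) = (1 - a) / (1 - a * \<gamma>)"
    using a_gamma unfolding L_tau L5_def by (simp add: divide_simps) (simp add: algebra_simps)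
  then have e: "(\<gamma> - 1) * (1 - a + a * (real L * \<tau>)) / (1 - a) = real B * \<tau>"
    using B_tau a_less_1 by (simp add: Lb_def)
  then have 1: "low_time L = real B * \<tau>"
    using NL by (simp add: low_time_def)
  then show "low L = B" using tau_pos by (simp add: low_def)
  have 2: "low_time (Suc L) = real B * \<tau> + (\<gamma> - 1) * a * \<tau> / (1 - a)"
  proof -
    have "(\<gamma> - 1) * (1 - a + a * (real (Suc L) * \<tau>))
        = (\<gamma> - 1) * (1 - a + a * (real L * \<tau>)) + (\<gamma> - 1) * a * \<tau>"
      by (simp add: algebra_simps)
    then show ?thesis using NL by (simp add: low_time_def add_divide_distrib flip: e)
  qed
  have "(\<gamma> - 1) * a < 1 - a" using a_gamma by (simp add: algebra_simps)
  then have 3: "(\<gamma> - 1) * a * \<tau> / (1 - a) < \<tau>"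
    using a_less_1 tau_pos by (simp add: pos_divide_less_eq mult.commute)
  have 4: "0 \<le> (\<gamma> - 1) * a * \<tau> / (1 - a)"
    using a_less_1 tau_pos a_nonneg gamma_gt_1 by simp
  have "low (Suc L) < Suc B"
    using 2 3 by (simp add: low_less_iff algebra_simps)
  moreover have "B \<le> low (Suc L)"
    using 2 4 le_low_iff[of B "Suc L"] by (cases "B = 0") auto
  ultimately show "low (Suc L) = B" by simp
qed

lemma N_le_B: "N \<le> B"
  using N_le_low[of L] low_L N_le_I I_less_L by simp

lemma B_less_L: "B < L"
  using L_eq N_pos by simp

text \<open>\<open>low_time k\<close> is the solution \<open>t\<close> of the equation that sets the
  ratio for buying at \<open>t\<close> to \<open>\<gamma>\<close>, in each of the two regimes of the
  denominator.\<close>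

lemma gamma_less_ratio_buy_iff:
  assumes "0 < k" "j \<le> k"
  shows "\<gamma> < ratio_buy a (real j * \<tau>) (real k * \<tau>) \<longleftrightarrow> low_time k < real j * \<tau>"
proof -
  have jk: "real j * \<tau> \<le> real k * \<tau>" using assms by (simp add: time_le_iff)
  have kp: "0 < real k * \<tau>" using assms tau_pos by simp
  show ?thesis
  proof (cases "k \<le> N")
    case True
    then have "real k * \<tau> \<le> 1" using N_tau by (metis time_le_iff)
    then have "\<gamma> < ratio_buy a (real j * \<tau>) (real k * \<tau>)
      \<longleftrightarrow> \<gamma> * (real k * \<tau>) < real j * \<tau> + 1 - a + a * (real k * \<tau> - real j * \<tau>)"
      using jk kp by (simp only: ratio_buy_def if_True pos_less_divide_eq)
    also have "\<dots> \<longleftrightarrow> real k * \<tau> * (\<gamma> - 1) < (1 + real j * \<tau> - real k * \<tau>) * (1 - a)"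
      by (simp add: algebra_simps)
    also have "\<dots> \<longleftrightarrow> real k * \<tau> * (\<gamma> - 1) / (1 - a) < 1 + real j * \<tau> - real k * \<tau>"
      using a_less_1 by (simp add: pos_divide_less_eq)
    finally show ?thesis using True by (simp add: low_time_def) linarith
  next
    case False
    then have k1: "1 < real k * \<tau>" using N_tau by (metis not_le time_le_iff)
    have "0 < 1 - a + a * (real k * \<tau>)" using a_less_1 a_nonneg kp by (simp add: add_pos_nonneg)
    then have "\<gamma> < ratio_buy a (real j * \<tau>) (real k * \<tau>)
      \<longleftrightarrow> \<gamma> * (1 - a + a * (real k * \<tau>)) < real j * \<tau> + 1 - a + a * (real k * \<tau> - real j * \<tau>)"
      using jk k1 by (simp add: ratio_buy_def pos_less_divide_eq)
    also have "\<dots> \<longleftrightarrow> (\<gamma> - 1) * (1 - a + a * (real k * \<tau>)) < real j * \<tau> * (1 - a)"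
      by (simp add: algebra_simps)
    finally show ?thesis using False a_less_1 by (simp add: low_time_def pos_divide_less_eq)
  qed
qed

lemma gamma_less_ratio_never_iff:
  assumes "0 < k"
  shows "\<gamma> < ratio_never a (real k * \<tau>) \<longleftrightarrow> L < k"
proof (cases "k \<le> N")
  case True
  then show ?thesis
    using N_tau gamma_gt_1 N_le_I I_less_L time_le_iff[of k N] by (simp add: ratio_never_def)
next
  case False
  then have k1: "1 < real k * \<tau>" using N_tau by (metis not_le time_le_iff)
  then have "0 < 1 - a + a * (real k * \<tau>)" using a_less_1 a_nonneg by (simp add: add_pos_nonneg)
  then have "\<gamma> < ratio_never a (real k * \<tau>) \<longleftrightarrow> \<gamma> * (1 - a + a * (real k * \<tau>)) < real k * \<tau>"
    using k1 by (simp add: ratio_never_def pos_less_divide_eq)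
  also have "\<dots> \<longleftrightarrow> \<gamma> * (1 - a) < real k * \<tau> * (1 - a * \<gamma>)" by (simp add: algebra_simps)
  also have "\<dots> \<longleftrightarrow> L5 a \<gamma> < real k * \<tau>" using a_gamma by (simp add: L5_def pos_divide_less_eq)
  finally show ?thesis using L_tau by (metis time_less_iff)
qed

lemma ratio_buy_later:
  "k < j \<Longrightarrow> ratio_buy a (real j * \<tau>) (real k * \<tau>) = ratio_never a (real k * \<tau>)"
  using tau_pos by (simp add: ratio_buy_def ratio_never_def)

lemma enat_in_bad_iff:
  assumes "0 < k"
  shows "enat j \<in> bad a \<gamma> \<tau> (enat k) \<longleftrightarrow> low k < j \<and> (j \<le> k \<or> L < k)"
proof -
  have "0 \<le> \<gamma>" using gamma_gt_1 by simp
  then have "enat j \<in> bad a \<gamma> \<tau> (enat k) \<longleftrightarrow> 1 \<le> j \<and> \<gamma> < ratio_buy a (real j * \<tau>) (real k * \<tau>)"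
    by (simp add: bad_def ratio_def ennreal_less_iff one_enat_def)
  also have "\<dots> \<longleftrightarrow> low k < j \<and> (j \<le> k \<or> L < k)"
  proof (cases "j \<le> k")
    case True
    then show ?thesis using gamma_less_ratio_buy_iff[OF assms True] by (simp add: low_less_iff)
  next
    case False
    have "low k < j" if "L < k"
      using low_less_self_iff[OF assms] False I_less_L that by linarith
    with False show ?thesis
      using gamma_less_ratio_never_iff[OF assms] by (auto simp: ratio_buy_later)
  qed
  finally show ?thesis .
qed

lemma infinity_in_bad_iff:
  assumes "0 < k"
  shows "\<infinity> \<in> bad a \<gamma> \<tau> (enat k) \<longleftrightarrow> L < k"
  using gamma_gt_1 gamma_less_ratio_never_iff[OF assms] by (simp add: bad_def ratio_def ennreal_less_iff)

lemma bad_early: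
  assumes "0 < k" "k \<le> L"
  shows "bad a \<gamma> \<tau> (enat k) = enat ` {low k<..k}"
proof (rule set_eqI)
  fix t :: enat
  show "t \<in> bad a \<gamma> \<tau> (enat k) \<longleftrightarrow> t \<in> enat ` {low k<..k}"
    using enat_in_bad_iff[OF assms(1)] infinity_in_bad_iff[OF assms(1)] assms(2)
    by (cases t) (auto simp: image_iff)
qed

lemma bad_late:
  assumes "L < k"
  shows "bad a \<gamma> \<tau> (enat k) = {enat (low k)<..}"
proof (rule set_eqI)
  fix t :: enat
  have "0 < k" using assms by simp
  then show "t \<in> bad a \<gamma> \<tau> (enat k) \<longleftrightarrow> t \<in> {enat (low k)<..}"
    using enat_in_bad_iff[of k] infinity_in_bad_iff[of k] assms
    by (cases t) auto
qed

text \<open>An inclusion suffices: the mass at infinity lies after \<open>B\<close>, so the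
  constraint at \<open>Suc L\<close> already bounds it.\<close>

lemma bad_infinity_subset: "bad a \<gamma> \<tau> \<infinity> \<subseteq> {\<infinity>}"
proof -
  have "\<not> ennreal \<gamma> < 1" using gamma_gt_1 by (simp add: ennreal_less_one_iff)
  then show ?thesis by (auto simp: bad_def ratio_def split: enat.splits)
qed

subsection \<open>Constraints on cumulative masses\<close>

text \<open>The bound on the sum of \<open>(1 + t - x)\<close> times the mass at \<open>t\<close>,
  over \<open>t \<le> x\<close>, that results from solving the ratio constraint at \<open>x\<close>.
  The two branches agree at time 1.\<close>

definition cap :: "real \<Rightarrow> nat \<Rightarrow> real" where
  "cap P k = (if k \<le> N then real k * \<tau> * (P - 1) / (1 - a)
              else ((1 - a + a * (real k * \<tau>)) * P - real k * \<tau>) / (1 - a))"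

text \<open>
  Summation by parts turns \<open>\<Sum>\<^bsub>t \<le> x\<^esub> (1 + t - x) f\<^sub>t\<close> into the cumulative mass at \<open>x\<close> minus \<open>\<tau>\<close> times
  the sum of the earlier cumulative masses, so the ratio constraint becomes \<open>V k \<le> reach P V k\<close>.
\<close>

definition reach :: "real \<Rightarrow> (nat \<Rightarrow> real) \<Rightarrow> nat \<Rightarrow> real" where
  "reach P V k = cap P k + \<tau> * (\<Sum>j<k. V j)"

definition cum :: "enat pmf \<Rightarrow> nat \<Rightarrow> real" where
  "cum f k = (\<Sum>j\<in>{1..k}. pmf f (enat j))"

section \<open>Feasibility and ratios in terms of cumulative masses\<close>

lemma cum_0 [simp]: "cum f 0 = 0"
  by (simp add: cum_def)

lemma cum_Suc: "cum f (Suc k) = cum f k + pmf f (enat (Suc k))"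
  by (simp add: cum_def)

lemma cum_nonneg: "0 \<le> cum f k"
  by (simp add: cum_def sum_nonneg)

lemma cum_mono: "j \<le> k \<Longrightarrow> cum f j \<le> cum f k"
  unfolding cum_def by (intro sum_mono2) auto

lemma prob_enat_interval:
  "measure_pmf.prob f (enat ` {j<..k}) = cum f k - cum f (min j k)"
proof -
  have "measure_pmf.prob f (enat ` {j<..k}) = (\<Sum>t\<in>enat ` {j<..k}. pmf f t)"
    by (intro measure_measure_pmf_finite) simp
  also have "\<dots> = (\<Sum>i\<in>{j<..k}. pmf f (enat i))"
    by (subst sum.reindex) (auto simp: inj_on_def)
  also have "\<dots> = cum f k - cum f (min j k)"
  proof -
    have "{1..k} = {1..min j k} \<union> {j<..k}" by auto
    then have "cum f k = cum f (min j k) + (\<Sum>i\<in>{j<..k}. pmf f (enat i))"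
      unfolding cum_def by (subst sum.union_disjoint[symmetric]) auto
    then show ?thesis by simp
  qed
  finally show ?thesis .
qed

lemma prob_after:
  assumes "set_pmf f \<subseteq> {1..}"
  shows "measure_pmf.prob f {enat k<..} = 1 - cum f k"
proof -
  have "measure_pmf.prob f {enat k<..} = 1 - measure_pmf.prob f (- {enat k<..})"
    by (subst measure_pmf.prob_compl[symmetric]) (auto simp: Compl_eq_Diff_UNIV double_diff)
  also have "measure_pmf.prob f (- {enat k<..}) = measure_pmf.prob f (enat ` {0<..k})"
  proof (rule measure_eq_AE)
    show "AE t in measure_pmf f. t \<in> - {enat k<..} \<longleftrightarrow> t \<in> enat ` {0<..k}"
    proof (subst AE_measure_pmf_iff, intro ballI)
      fix t assume "t \<in> set_pmf f"
      then have "1 \<le> t" using assms by auto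
      then show "t \<in> - {enat k<..} \<longleftrightarrow> t \<in> enat ` {0<..k}"
        by (cases t) (auto simp: one_enat_def)
    qed
  qed auto
  also have "\<dots> = cum f k" by (simp add: prob_enat_interval)
  finally show ?thesis .
qed

lemma cum_le_1: "set_pmf f \<subseteq> {1..} \<Longrightarrow> cum f k \<le> 1"
  using prob_after[of f k] measure_nonneg[of f "{enat k<..}"] by linarith

text \<open>Finitely many constraints remain: for every \<open>k > L\<close> the bad interval starts
  at or after \<open>B\<close>, so all these constraints and the one at infinity follow from the one
  at \<open>Suc L\<close>, which says that the mass after \<open>B\<close> is at most
  \<open>\<delta>\<close>. The \<open>min\<close> covers empty bad intervals.\<close>

lemma feasible_iff:
  "feasible a \<gamma> \<delta> \<tau> f \<longleftrightarrow> set_pmf f \<subseteq> {1..} \<and>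
     (\<forall>k\<in>{1..L}. cum f k - cum f (min (low k) k) \<le> \<delta>) \<and> 1 - cum f B \<le> \<delta>"
proof (cases "set_pmf f \<subseteq> {1..}")
  case True
  have inf: "measure_pmf.prob f (bad a \<gamma> \<tau> \<infinity>) \<le> 1 - cum f B"
  proof -
    have "bad a \<gamma> \<tau> \<infinity> \<subseteq> {enat B<..}" using bad_infinity_subset by fastforce
    then show ?thesis
      unfolding prob_after[OF True, symmetric] by (intro measure_pmf.finite_measure_mono) auto
  qed
  have late: "measure_pmf.prob f (bad a \<gamma> \<tau> (enat k)) \<le> 1 - cum f B" if "L < k" for k
  proof -
    have "B \<le> low k"
      using low_mono_late[of "Suc L" k] that low_Suc_L N_le_I I_less_L by simp
    then show ?thesis using bad_late[OF that] prob_after[OF True] cum_mono by simp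
  qed
  have "feasible a \<gamma> \<delta> \<tau> f \<longleftrightarrow> (\<forall>x\<ge>1. measure_pmf.prob f (bad a \<gamma> \<tau> x) \<le> \<delta>)"
    using True by (simp add: feasible_def)
  also have "\<dots> \<longleftrightarrow> (\<forall>k\<in>{1..L}. measure_pmf.prob f (bad a \<gamma> \<tau> (enat k)) \<le> \<delta>) \<and> 1 - cum f B \<le> \<delta>"
    (is "?l \<longleftrightarrow> ?r1 \<and> ?r2")
  proof
    assume l: ?l
    then have "measure_pmf.prob f (bad a \<gamma> \<tau> (enat (Suc L))) \<le> \<delta>"
      by (simp add: one_enat_def)
    then have "?r2" using bad_late[of "Suc L"] prob_after[OF True] low_Suc_L by simp
    with l show "?r1 \<and> ?r2" by (auto simp: one_enat_def)
  next
    assume r: "?r1 \<and> ?r2"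
    show ?l
    proof (intro allI impI)
      fix x :: enat assume x: "1 \<le> x"
      show "measure_pmf.prob f (bad a \<gamma> \<tau> x) \<le> \<delta>"
      proof (cases x)
        case (enat k)
        then show ?thesis using r late[of k] x by (cases "k \<le> L") (auto simp: one_enat_def)
      next
        case infinity
        then show ?thesis using inf r by simp
      qed
    qed
  qed
  also have "?r1 \<longleftrightarrow> (\<forall>k\<in>{1..L}. cum f k - cum f (min (low k) k) \<le> \<delta>)"
    by (simp add: bad_early prob_enat_interval)
  finally show ?thesis using True by simp
qed (simp add: feasible_def)

text \<open>Passing from \<open>k\<close> to \<open>Suc k\<close> lowers every old weight by
  \<open>\<tau>\<close>, and the new point has weight 1.\<close>

lemma weighted_sum_eq:
  "(\<Sum>j\<in>{1..k}. (1 + real j * \<tau> - real k * \<tau>) * v j)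
     = (\<Sum>j\<in>{1..k}. v j) - \<tau> * (\<Sum>i<k. \<Sum>j\<in>{1..i}. v j)" for v :: "nat \<Rightarrow> real"
proof (induction k)
  case (Suc k)
  have "(\<Sum>j\<in>{1..Suc k}. (1 + real j * \<tau> - real (Suc k) * \<tau>) * v j)
      = (\<Sum>j\<in>{1..k}. (1 + real j * \<tau> - real k * \<tau>) * v j - \<tau> * v j) + v (Suc k)"
    by (simp add: algebra_simps)
  also have "\<dots> = (\<Sum>j\<in>{1..k}. (1 + real j * \<tau> - real k * \<tau>) * v j) - \<tau> * (\<Sum>j\<in>{1..k}. v j) + v (Suc k)"
    by (simp only: sum_subtractf sum_distrib_left)
  finally show ?case using Suc by (simp add: algebra_simps)
qed simp

text \<open>Buying at \<open>t \<le> x\<close> changes the ratio of never buying by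
  \<open>(1 - a) * (1 + t - x)\<close> over the common denominator, and buying later does not change
  it. So the ratio is a constant plus finitely many multiples of indicators, and its expectation is
  a finite sum.\<close>

lemma expected_ratio_enat:
  assumes "0 < k" "set_pmf f \<subseteq> {1..}"
  shows "expected_ratio a \<tau> f (enat k) =
    ennreal (ratio_never a (real k * \<tau>) + (1 - a) * (cum f k - \<tau> * (\<Sum>i<k. cum f i)) /
      (if k \<le> N then real k * \<tau> else 1 - a + a * (real k * \<tau>)))"
proof -
  define D where "D = (if k \<le> N then real k * \<tau> else 1 - a + a * (real k * \<tau>))"
  define r where "r t = (case t of enat j \<Rightarrow> ratio_buy a (real j * \<tau>) (real k * \<tau>)
    | \<infinity> \<Rightarrow> ratio_never a (real k * \<tau>))" for t
  define n where "n = ratio_never a (real k * \<tau>)"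
  have kp: "0 < real k * \<tau>" using assms tau_pos by simp
  have D: "0 < D" using kp a_less_1 a_nonneg by (simp add: D_def add_pos_nonneg)
  have kN: "k \<le> N \<longleftrightarrow> real k * \<tau> \<le> 1" using N_tau by (metis time_le_iff)
  have buy: "ratio_buy a (real j * \<tau>) (real k * \<tau>) = n + (1 - a) * (1 + real j * \<tau> - real k * \<tau>) / D"
    if "j \<le> k" for j
  proof -
    define t x where "t = real j * \<tau>" and "x = real k * \<tau>"
    have "t \<le> x" using that by (simp add: time_le_iff t_def x_def)
    moreover have "(t + 1 - a + a * (x - t)) / x = 1 + (1 - a) * (1 + t - x) / x"
      using kp[folded x_def] by (simp add: diff_divide_distrib add_divide_distrib algebra_simps)
    moreover have "(t + 1 - a + a * (x - t)) / D = x / D + (1 - a) * (1 + t - x) / D"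
      unfolding add_divide_distrib[symmetric] by (simp add: algebra_simps)
    ultimately show ?thesis
      by (auto simp: ratio_buy_def ratio_never_def n_def D_def kN x_def t_def)
  qed
  have r: "r t = n + (\<Sum>j\<in>{1..k}. (1 - a) * (1 + real j * \<tau> - real k * \<tau>) / D * indicator {enat j} t)"
    if t: "1 \<le> t" for t
  proof -
    have "(\<Sum>j\<in>{1..k}. (1 - a) * (1 + real j * \<tau> - real k * \<tau>) / D * indicator {enat j} t)
      = (\<Sum>j\<in>{1..k}. if t = enat j then (1 - a) * (1 + real j * \<tau> - real k * \<tau>) / D else 0)"
      by (intro sum.cong) (auto simp: indicator_def)
    then show ?thesis using t buy
      by (cases t) (auto simp: r_def n_def one_enat_def ratio_buy_later split: if_splits)
  qed
  have r0: "0 \<le> r t" for t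
  proof -
    have "0 \<le> real j * \<tau> + 1 - a + a * (real k * \<tau> - real j * \<tau>)" if "real j * \<tau> \<le> real k * \<tau>" for j
      using that a_less_1 a_nonneg tau_pos mult_nonneg_nonneg[of a "real k * \<tau> - real j * \<tau>"]
        mult_nonneg_nonneg[of "real j" \<tau>] by linarith
    moreover have "0 \<le> 1 - a + a * (real k * \<tau>)" using kp a_nonneg a_less_1 by simp
    ultimately show ?thesis using kp
      by (auto simp: r_def ratio_buy_def ratio_never_def split: enat.splits)
  qed
  have int: "integrable f (\<lambda>t. n + (\<Sum>j\<in>{1..k}. (1 - a) * (1 + real j * \<tau> - real k * \<tau>) / D * indicator {enat j} t))"
    by (intro Bochner_Integration.integrable_add Bochner_Integration.integrable_sum
        integrable_mult_right) (auto simp: less_top[symmetric])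
  have AE: "AE t in measure_pmf f. r t = n + (\<Sum>j\<in>{1..k}. (1 - a) * (1 + real j * \<tau> - real k * \<tau>) / D * indicator {enat j} t)"
    using assms(2) by (intro AE_pmfI r) auto
  have "expected_ratio a \<tau> f (enat k) = (\<integral>\<^sup>+ t. ennreal (r t) \<partial>measure_pmf f)"
    unfolding expected_ratio_def by (intro nn_integral_cong) (simp add: ratio_def r_def split: enat.splits)
  also have "\<dots> = ennreal (\<integral> t. r t \<partial>measure_pmf f)"
  proof (intro nn_integral_eq_integral)
    show "integrable f r" using int AE by (subst integrable_cong_AE[OF _ _ AE]) auto
  qed (simp add: r0)
  also have "(\<integral> t. r t \<partial>measure_pmf f) = (\<integral> t. n + (\<Sum>j\<in>{1..k}. (1 - a) * (1 + real j * \<tau> - real k * \<tau>) / D * indicator {enat j} t) \<partial>measure_pmf f)"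
    by (intro integral_cong_AE AE) auto
  also have "\<dots> = n + (\<Sum>j\<in>{1..k}. (1 - a) * (1 + real j * \<tau> - real k * \<tau>) / D * pmf f (enat j))"
    by (subst Bochner_Integration.integral_add, simp, simp add: less_top[symmetric],
        subst Bochner_Integration.integral_sum)
       (auto simp: less_top[symmetric] pmf.rep_eq)
  also have "\<dots> = n + (1 - a) / D * (\<Sum>j\<in>{1..k}. (1 + real j * \<tau> - real k * \<tau>) * pmf f (enat j))"
    by (simp add: sum_distrib_left mult_ac)
  also have "\<dots> = n + (1 - a) * (cum f k - \<tau> * (\<Sum>i<k. cum f i)) / D"
    unfolding weighted_sum_eq by (simp add: cum_def)
  finally show ?thesis unfolding n_def D_def .
qed

lemma expected_ratio_le_iff:
  assumes "0 < k" "set_pmf f \<subseteq> {1..}" "0 \<le> P"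
  shows "expected_ratio a \<tau> f (enat k) \<le> ennreal P \<longleftrightarrow> cum f k \<le> reach P (cum f) k"
proof -
  define S where "S = cum f k - \<tau> * (\<Sum>i<k. cum f i)"
  have kp: "0 < real k * \<tau>" using assms tau_pos by simp
  have D: "0 < 1 - a + a * (real k * \<tau>)" using kp a_less_1 a_nonneg by (simp add: add_pos_nonneg)
  have kN: "k \<le> N \<longleftrightarrow> real k * \<tau> \<le> 1" using N_tau by (metis time_le_iff)
  have "expected_ratio a \<tau> f (enat k) \<le> ennreal P \<longleftrightarrow>
    ratio_never a (real k * \<tau>) + (1 - a) * S / (if k \<le> N then real k * \<tau> else 1 - a + a * (real k * \<tau>)) \<le> P"
    using assms by (simp add: expected_ratio_enat S_def ennreal_le_iff)
  also have "\<dots> \<longleftrightarrow> S \<le> cap P k"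
  proof (cases "k \<le> N")
    case True
    have "1 + (1 - a) * S / x \<le> P \<longleftrightarrow> S \<le> x * (P - 1) / (1 - a)" if "0 < x" for x
    proof -
      have "1 + (1 - a) * S / x \<le> P \<longleftrightarrow> (1 - a) * S / x \<le> P - 1" by linarith
      also have "\<dots> \<longleftrightarrow> (1 - a) * S \<le> (P - 1) * x" using that by (rule pos_divide_le_eq)
      also have "\<dots> \<longleftrightarrow> S \<le> x * (P - 1) / (1 - a)"
        using a_less_1 by (simp add: pos_le_divide_eq mult.commute)
      finally show ?thesis .
    qed
    from this[OF kp] show ?thesis using True kN by (simp add: ratio_never_def cap_def)
  next
    case False
    have "x / D + (1 - a) * S / D \<le> P \<longleftrightarrow> S \<le> (D * P - x) / (1 - a)" if "0 < D" for x D
    proof -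
      have "x / D + (1 - a) * S / D \<le> P \<longleftrightarrow> (x + (1 - a) * S) / D \<le> P"
        by (simp only: add_divide_distrib)
      also have "\<dots> \<longleftrightarrow> x + (1 - a) * S \<le> P * D" using that by (rule pos_divide_le_eq)
      also have "\<dots> \<longleftrightarrow> (1 - a) * S \<le> D * P - x" by (simp add: algebra_simps)
      also have "\<dots> \<longleftrightarrow> S \<le> (D * P - x) / (1 - a)"
        using a_less_1 by (simp add: pos_le_divide_eq mult.commute)
      finally show ?thesis .
    qed
    from this[OF D] show ?thesis using False kN by (simp add: ratio_never_def cap_def)
  qed
  finally show ?thesis by (simp add: S_def reach_def algebra_simps)
qed

section \<open>The stopping time infinity, and the worst case over all stopping times\<close>

lemma expected_ratio_infinity:
  "expected_ratio a \<tau> f \<infinity> = ennreal (1 - pmf f \<infinity>) + 1 / ennreal a * ennreal (pmf f \<infinity>)"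
proof -
  have "expected_ratio a \<tau> f \<infinity> =
      (\<integral>\<^sup>+ t. indicator (- {\<infinity>}) t + 1 / ennreal a * indicator {\<infinity>} t \<partial>measure_pmf f)"
    unfolding expected_ratio_def by (intro nn_integral_cong) (auto simp: ratio_def split: enat.splits)
  also have "\<dots> = emeasure f (- {\<infinity>}) + 1 / ennreal a * emeasure f {\<infinity>}"
    by (subst nn_integral_add) (auto simp: nn_integral_cmult)
  also have "emeasure f (- {\<infinity>}) = ennreal (1 - pmf f \<infinity>)"
    using measure_pmf.prob_compl[of "{\<infinity>}" f]
    by (simp add: measure_pmf.emeasure_eq_measure Compl_eq_Diff_UNIV pmf.rep_eq)
  finally show ?thesis by (simp add: measure_pmf.emeasure_eq_measure pmf.rep_eq)
qed

lemma one_le_expected_ratio_infinity: "1 \<le> expected_ratio a \<tau> f \<infinity>"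
proof -
  have "1 \<le> 1 / ennreal a"
  proof (cases "a = 0")
    case False
    then show ?thesis using a_nonneg a_less_1
      by (simp add: divide_ennreal flip: ennreal_1)
  qed simp
  then have "ennreal (1 - pmf f \<infinity>) + ennreal (pmf f \<infinity>) \<le> expected_ratio a \<tau> f \<infinity>"
    unfolding expected_ratio_infinity by (metis add_left_mono mult_1 mult_right_mono zero_le)
  moreover have "ennreal (1 - pmf f \<infinity>) + ennreal (pmf f \<infinity>) = 1"
    by (simp add: pmf_le_1 flip: ennreal_plus)
  ultimately show ?thesis by simp
qed

text \<open>The first assumption is the ratio bound at infinity cleared of \<open>1 / a\<close>; in
  this form it is also correct for \<open>a = 0\<close>, where it forbids mass at infinity.\<close>

lemma expected_ratio_infinity_le:
  assumes "pmf f \<infinity> * (1 - a) \<le> a * (P - 1)" "1 \<le> P"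
  shows "expected_ratio a \<tau> f \<infinity> \<le> ennreal P"
proof (cases "a = 0")
  case True
  then have "pmf f \<infinity> = 0" using assms pmf_nonneg[of f \<infinity>] by simp
  then show ?thesis using assms by (simp add: expected_ratio_infinity)
next
  case False
  then have "0 < a" using a_nonneg by simp
  then have "expected_ratio a \<tau> f \<infinity> = ennreal (1 - pmf f \<infinity> + 1 / a * pmf f \<infinity>)"
    by (simp add: expected_ratio_infinity divide_ennreal pmf_le_1 flip: ennreal_1 ennreal_mult ennreal_plus)
  also have "1 - pmf f \<infinity> + 1 / a * pmf f \<infinity> \<le> P"
    using assms \<open>0 < a\<close> by (simp add: field_simps)
  finally show ?thesis by (simp add: ennreal_leI)
qed

lemma worst_ratio_le:
  assumes "set_pmf f \<subseteq> {1..}" "1 \<le> P" "\<And>k. 0 < k \<Longrightarrow> cum f k \<le> reach P (cum f) k"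
    "pmf f \<infinity> * (1 - a) \<le> a * (P - 1)"
  shows "worst_ratio a \<tau> f \<le> ennreal P"
  unfolding worst_ratio_def
proof (rule SUP_least)
  fix x :: enat assume "x \<in> {1..}"
  show "expected_ratio a \<tau> f x \<le> ennreal P"
  proof (cases x)
    case (enat k)
    with \<open>x \<in> {1..}\<close> have "0 < k" by (auto simp: one_enat_def)
    then show ?thesis
      using enat assms(3)[OF \<open>0 < k\<close>] assms(1,2) by (subst enat, subst expected_ratio_le_iff) auto
  next
    case infinity
    then show ?thesis using expected_ratio_infinity_le[OF assms(4,2)] by simp
  qed
qed

lemma ex_pmf_cum:
  assumes "V 0 = 0" "mono V" "\<And>k. n \<le> k \<Longrightarrow> V k = V n" "V n \<le> 1"
  shows "\<exists>f :: enat pmf. set_pmf f \<subseteq> {1..} \<and> (\<forall>j. pmf f (enat j) = V j - V (j - 1)) \<and>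
    pmf f \<infinity> = 1 - V n \<and> cum f = V"
proof -
  \<comment> \<open>At \<open>j = 0\<close> truncated subtraction gives mass
    \<open>V 0 - V 0 = 0\<close>, so the support starts at 1. The mass missing from
    \<open>V n\<close> goes to infinity.\<close>
  define v where "v t = (case t of enat j \<Rightarrow> V j - V (j - 1) | \<infinity> \<Rightarrow> 1 - V n)" for t
  have v0: "0 \<le> v t" for t
    using assms(4) monoD[OF assms(2), of "j - 1" j for j] by (auto simp: v_def split: enat.splits)
  have sumV: "(\<Sum>j\<in>{1..k}. V j - V (j - 1)) = V k" for k
    using assms(1) by (induction k) auto
  let ?A = "insert \<infinity> (enat ` {1..n})"
  have z: "v t = 0" if "t \<notin> ?A" for t
  proof (cases t)
    case (enat j)
    then have "j = 0 \<or> n \<le> j - 1" using that by (auto simp: image_iff)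
    then have "V j = V (j - 1)" using assms(3)[of j] assms(3)[of "j - 1"] by auto
    then show ?thesis by (simp add: v_def enat)
  qed (use that in auto)
  have "(\<integral>\<^sup>+ t. ennreal (v t) \<partial>count_space UNIV) = (\<Sum>t\<in>?A. ennreal (v t))"
    using z by (intro nn_integral_count_space') auto
  also have "\<dots> = ennreal (\<Sum>t\<in>?A. v t)" by (simp add: v0)
  also have "(\<Sum>t\<in>?A. v t) = v \<infinity> + (\<Sum>j\<in>{1..n}. v (enat j))"
  proof -
    have "sum v (enat ` {1..n}) = (\<Sum>j\<in>{1..n}. v (enat j))"
      by (subst sum.reindex) (auto simp: inj_on_def)
    then show ?thesis by (subst sum.insert) auto
  qed
  also have "\<dots> = 1"
  proof -
    have "(\<Sum>j\<in>{1..n}. v (enat j)) = (\<Sum>j\<in>{1..n}. V j - V (j - 1))" by (simp add: v_def)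
    also have "\<dots> = V n" by (rule sumV)
    finally show ?thesis by (simp add: v_def)
  qed
  finally have 1: "(\<integral>\<^sup>+ t. ennreal (v t) \<partial>count_space UNIV) = 1" by simp
  have pmf: "pmf (embed_pmf v) t = v t" for t
    using v0 1 by (intro pmf_embed_pmf) auto
  have "set_pmf (embed_pmf v) \<subseteq> {1..}"
  proof
    fix t assume "t \<in> set_pmf (embed_pmf v)"
    then have "v t \<noteq> 0" by (simp add: set_pmf_iff pmf)
    then show "t \<in> {1..}" by (cases t) (auto simp: v_def one_enat_def intro!: Suc_leI gr0I)
  qed
  moreover have "cum (embed_pmf v) = V"
  proof
    fix k
    have "cum (embed_pmf v) k = (\<Sum>j\<in>{1..k}. V j - V (j - 1))" by (simp add: cum_def pmf v_def)
    also have "\<dots> = V k" by (rule sumV)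
    finally show "cum (embed_pmf v) k = V k" .
  qed
  ultimately show ?thesis by (intro exI[of _ "embed_pmf v"]) (simp add: pmf v_def)
qed

subsection \<open>The masses assigned by the algorithm\<close>

text \<open>The masses of all steps, without step (iv) and without the stopping test of the loop.\<close>

primrec run :: "real \<Rightarrow> nat \<Rightarrow> enat \<Rightarrow> real" where
  "run P 0 = (\<lambda>_. 0)"
| "run P (Suc k) = (run P k)(enat (Suc k) :=
     (if Suc k \<le> N then head_mass a \<gamma> \<delta> \<tau> P (run P k) (Suc k)
      else late_cap a \<gamma> \<delta> \<tau> P (run P k) (Suc k)))"

definition run_cum :: "real \<Rightarrow> nat \<Rightarrow> real" where
  "run_cum P k = (\<Sum>j\<in>{1..k}. run P k (enat j))"

section \<open>Recurrences for the greedy cumulative masses\<close>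

lemma run_cum_0 [simp]: "run_cum P 0 = 0"
  by (simp add: run_cum_def)

lemma head_eq_run: "k \<le> N \<Longrightarrow> head a \<gamma> \<delta> \<tau> P k = run P k"
  by (induction k) auto

lemma run_outside: "j = 0 \<or> k < j \<Longrightarrow> run P k (enat j) = 0"
  by (induction k) (auto simp: zero_enat_def)

lemma run_infinity: "run P k \<infinity> = 0"
  by (induction k) auto

lemma run_stable: "j \<le> k \<Longrightarrow> run P k (enat j) = run P j (enat j)"
  by (induction k) (auto simp: le_Suc_eq)

lemma sum_run: "i \<le> k \<Longrightarrow> (\<Sum>j\<in>{1..i}. run P k (enat j)) = run_cum P i"
  unfolding run_cum_def by (intro sum.cong refl) (metis atLeastAtMost_iff order_trans run_stable)

lemma run_cum_Suc: "run_cum P (Suc k) = run_cum P k + run P (Suc k) (enat (Suc k))"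
proof -
  have "run_cum P (Suc k) = (\<Sum>j\<in>{1..k}. run P (Suc k) (enat j)) + run P (Suc k) (enat (Suc k))"
    unfolding run_cum_def by (subst sum.nat_ivl_Suc') auto
  then show ?thesis by (simp only: sum_run le_SucI order_refl)
qed

lemma run_eq_diff: "j \<le> k \<Longrightarrow> run P k (enat j) = run_cum P j - run_cum P (j - 1)"
  using run_stable[of j k P] run_cum_Suc[of P "j - 1"] by (cases j) (auto simp: run_outside)

lemma earlier_run:
  "earlier \<tau> (run P k) (Suc k) = run_cum P k - \<tau> * (\<Sum>i<Suc k. run_cum P i)"
proof -
  \<comment> \<open>The mass at \<open>Suc k\<close> is not assigned yet, so its term can be added
    to complete the sum to the form required by \<open>weighted_sum_eq\<close>.\<close>
  have z: "run P k (enat (Suc k)) = 0" by (intro run_outside) simp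
  have s: "(\<Sum>j\<in>{1..Suc k}. v j) = (\<Sum>j\<in>{1..<Suc k}. v j) + v (Suc k)" for v :: "nat \<Rightarrow> real"
    by (simp add: atLeastLessThanSuc_atLeastAtMost)
  have "earlier \<tau> (run P k) (Suc k) =
      (\<Sum>j\<in>{1..Suc k}. (1 + real j * \<tau> - real (Suc k) * \<tau>) * run P k (enat j))"
    unfolding earlier_def s z by simp
  also have "\<dots> = (\<Sum>j\<in>{1..Suc k}. run P k (enat j)) - \<tau> * (\<Sum>i<Suc k. \<Sum>j\<in>{1..i}. run P k (enat j))"
    by (rule weighted_sum_eq)
  also have "(\<Sum>j\<in>{1..Suc k}. run P k (enat j)) = run_cum P k"
    unfolding s z by (simp only: atLeastLessThanSuc_atLeastAtMost sum_run order_refl add_0_right)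
  also have "(\<Sum>i<Suc k. \<Sum>j\<in>{1..i}. run P k (enat j)) = (\<Sum>i<Suc k. run_cum P i)"
    by (intro sum.cong refl sum_run) auto
  finally show ?thesis .
qed

lemma ratio_cap_early_run:
  "Suc k \<le> N \<Longrightarrow> run_cum P k + ratio_cap_early a \<tau> P (run P k) (Suc k) = reach P (run_cum P) (Suc k)"
  unfolding ratio_cap_early_def earlier_run reach_def cap_def by simp

lemma ratio_cap_late_run:
  "N \<le> k \<Longrightarrow> run_cum P k + ratio_cap_late a \<tau> P (run P k) (Suc k) = reach P (run_cum P) (Suc k)"
  unfolding ratio_cap_late_def earlier_run reach_def cap_def
  by (simp add: diff_divide_distrib)

lemma sum_run_interval:
  "(\<Sum>j\<in>{i<..k}. run P k (enat j)) = run_cum P k - run_cum P (min i k)"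
proof -
  have "{1..k} = {1..min i k} \<union> {i<..k}" by auto
  then have "run_cum P k = (\<Sum>j\<in>{1..min i k}. run P k (enat j)) + (\<Sum>j\<in>{i<..k}. run P k (enat j))"
    unfolding run_cum_def by (subst sum.union_disjoint[symmetric]) auto
  then show ?thesis by (simp only: sum_run min.cobounded2)
qed

lemma tail_cap_run:
  assumes "Suc k \<le> L"
  shows "run_cum P k + tail_cap a \<gamma> \<delta> \<tau> (run P k) (Suc k) = \<delta> + run_cum P (min (low (Suc k)) k)"
proof -
  have "bad a \<gamma> \<tau> (enat (Suc k)) - {enat (Suc k)} = enat ` {low (Suc k)<..k}"
    using assms by (auto simp: bad_early)
  then have "(\<Sum>t\<in>bad a \<gamma> \<tau> (enat (Suc k)) - {enat (Suc k)}. run P k t)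
      = (\<Sum>j\<in>{low (Suc k)<..k}. run P k (enat j))"
    by (simp add: sum.reindex inj_on_def)
  then show ?thesis by (simp add: tail_cap_def sum_run_interval)
qed

lemma time_le_L3_iff: "real k * \<tau> < L3 a \<gamma> \<longleftrightarrow> k < M" "real k * \<tau> = L3 a \<gamma> \<longleftrightarrow> k = M"
  using M_tau time_less_iff[of k M] tau_pos by (auto simp flip: M_tau)

lemma add_min: "(x::real) + min y z = min (x + y) (x + z)"
  by (simp add: min_def)

text \<open>Adding the mass assigned so far turns the caps on a single mass into bounds on the
  cumulative mass. Step (i) always imposes the cap \<open>\<delta>\<close>, and \<open>1 < M\<close>
  makes this an instance of the tail bound.\<close>

lemma run_cum_head:
  assumes "Suc k \<le> N" "1 < M"
  shows "run_cum P (Suc k) =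
    (if Suc k < M \<or> Suc k = M \<and> 0 < \<delta>
     then min (\<delta> + run_cum P (min (low (Suc k)) k)) (reach P (run_cum P) (Suc k))
     else reach P (run_cum P) (Suc k))"
proof (cases "k = 0")
  case True
  then show ?thesis using assms
    by (simp add: run_cum_Suc head_mass_def reach_def cap_def mult.commute)
next
  case False
  have L: "Suc k \<le> L" using assms N_le_I I_less_L by simp
  show ?thesis
    using assms False
    by (simp add: run_cum_Suc head_mass_def time_le_L3_iff[of "Suc k", simplified] add_min
        flip: tail_cap_run[OF L] ratio_cap_early_run[OF assms(1)])
qed

lemma run_cum_late:
  assumes "N \<le> k"
  shows "run_cum P (Suc k) =
    (if Suc k \<le> I then reach P (run_cum P) (Suc k)
     else if Suc k \<le> L then min (\<delta> + run_cum P (min (low (Suc k)) k)) (reach P (run_cum P) (Suc k))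
     else min (\<delta> + run_cum P B) (reach P (run_cum P) (Suc k)))"
proof -
  have 1: "real (Suc k) * \<tau> \<le> I3 a \<gamma> \<longleftrightarrow> Suc k \<le> I" "real (Suc k) * \<tau> \<le> L5 a \<gamma> \<longleftrightarrow> Suc k \<le> L"
    unfolding I_tau[symmetric] L_tau[symmetric] time_le_iff by (rule refl)+
  have "{j \<in> {1..<Suc k}. Lb a \<gamma> < real j * \<tau>} = {B<..k}"
    unfolding B_tau[symmetric] time_less_iff by auto
  then have 2: "run_cum P k + (\<delta> - (\<Sum>j\<in>{j \<in> {1..<Suc k}. Lb a \<gamma> < real j * \<tau>}. run P k (enat j)))
      = \<delta> + run_cum P (min B k)"
    by (simp add: sum_run_interval)
  show ?thesis
  proof (cases "Suc k \<le> L")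
    case True
    have "run P (Suc k) (enat (Suc k)) = late_cap a \<gamma> \<delta> \<tau> P (run P k) (Suc k)"
      using assms by simp
    then show ?thesis using True unfolding run_cum_Suc late_cap_def 1
      by (simp only: if_True if_False add_min tail_cap_run[OF True] ratio_cap_late_run[OF assms]
          if_distrib[of "\<lambda>y. _ + y"] cong: if_cong)
  next
    case False
    then have "\<not> Suc k \<le> I" "min B k = B" using I_less_L B_less_L by auto
    then show ?thesis using False assms 2
      unfolding run_cum_Suc late_cap_def 1
      by (simp add: late_cap_def 1[simplified] add_min ratio_cap_late_run[OF assms])
  qed
qed

text \<open>\<open>1 - kappa P\<close> equals \<open>a * (P - 1) / (1 - a)\<close>, the largest mass
  at infinity allowed by the ratio at infinity and the one assigned in step (iv).\<close>

definition kappa :: "real \<Rightarrow> real" where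
  "kappa P = (1 - a * P) / (1 - a)"

text \<open>\<open>cap P\<close> is piecewise linear and continuous at time 1, so the increment from
  \<open>N\<close> to \<open>Suc N\<close> already has the late slope.\<close>

lemma cap_Suc: "cap P (Suc k) = cap P k + \<tau> * (if k < N then (P - 1) / (1 - a) else - kappa P)"
proof -
  have x: "\<tau> * real N = 1" using N_tau by (simp add: mult.commute)
  consider "k < N" | "k = N" | "N < k" by linarith
  then show ?thesis
  proof cases
    case 2
    have "cap P N = (P - 1) / (1 - a)" using N_tau by (simp add: cap_def)
    moreover have "cap P (Suc N) = ((P - 1) - \<tau> * (1 - a * P)) / (1 - a)"
      by (simp add: cap_def algebra_simps x)
    moreover have "((P - 1) - \<tau> * (1 - a * P)) / (1 - a) = (P - 1) / (1 - a) + \<tau> * - kappa P"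
      unfolding kappa_def diff_divide_distrib[of "P - 1" "\<tau> * (1 - a * P)"] by simp
    ultimately have "cap P (Suc N) = cap P N + \<tau> * - kappa P" by linarith
    then show ?thesis using 2 by simp
  qed (auto simp: cap_def kappa_def algebra_simps simp flip: add_divide_distrib diff_divide_distrib)
qed

lemma cap_0 [simp]: "cap P 0 = 0"
  by (simp add: cap_def)

lemma reach_0 [simp]: "reach P V 0 = 0"
  by (simp add: reach_def)

lemma reach_Suc:
  "reach P V (Suc k) = reach P V k +
     \<tau> * (V k + (if k < N then (P - 1) / (1 - a) else - kappa P))"
  by (simp add: reach_def cap_Suc algebra_simps)

lemma run_cum_le_reach:
  assumes "1 < M"
  shows "run_cum P k \<le> reach P (run_cum P) k"
proof (cases k)
  case (Suc j)
  then show ?thesis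
    using run_cum_head[of j P] run_cum_late[of j P] assms by (cases "Suc j \<le> N") auto
qed simp

text \<open>Both upper bounds are nondecreasing: the ratio bound grows by
  \<open>\<tau> * (run_cum P k + (P - 1) / (1 - a))\<close>, and the tail bound inherits
  monotonicity from \<open>low\<close> and the earlier masses. Before time 1 this needs only
  \<open>1 \<le> P\<close>, not optimality.\<close>

lemma run_cum_mono_early_step:
  assumes "1 < M" "1 \<le> P" "Suc k \<le> N"
  shows "0 \<le> run_cum P k \<and> run_cum P k \<le> run_cum P (Suc k)"
  using assms(3)
proof (induction k rule: less_induct)
  case (less k)
  have step: "run_cum P i \<le> run_cum P (Suc i)" if "i < k" for i
    using less that by simp
  have mono: "run_cum P i \<le> run_cum P j" if "i \<le> j" "j \<le> k" for i j
    using that(2,1)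
  proof (induction j)
    case (Suc j)
    then show ?case using step[of j] by (cases "i \<le> j") (auto simp: le_Suc_eq)
  qed simp
  have nonneg: "0 \<le> run_cum P k" using mono[of 0 k] by simp
  have beta: "0 \<le> (P - 1) / (1 - a)" using assms a_less_1 by simp
  have r: "run_cum P k \<le> reach P (run_cum P) (Suc k)"
  proof -
    have "0 \<le> \<tau> * (run_cum P k + (P - 1) / (1 - a))"
      using nonneg tau_pos beta by (intro mult_nonneg_nonneg) auto
    then show ?thesis
      using run_cum_le_reach[OF assms(1), of P k] less.prems by (simp add: reach_Suc)
  qed
  have t: "run_cum P k \<le> \<delta> + run_cum P (min (low (Suc k)) k)" if "Suc k \<le> M"
  proof (cases "k = 0")
    case True
    then show ?thesis using delta_nonneg by simp
  next
    case False
    then obtain j where j: "k = Suc j" by (cases k) auto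
    have "run_cum P k \<le> \<delta> + run_cum P (min (low k) j)"
      using run_cum_head[of j P] less.prems that assms(1) j by simp
    also have "run_cum P (min (low k) j) \<le> run_cum P (min (low (Suc k)) k)"
      using low_mono_early[of k "Suc k"] less.prems j by (intro mono) auto
    finally show ?thesis by simp
  qed
  show ?case using r t nonneg run_cum_head[OF less.prems assms(1), of P] by auto
qed

lemma run_cum_mono_early:
  assumes "1 < M" "1 \<le> P" "j \<le> k" "k \<le> N"
  shows "run_cum P j \<le> run_cum P k"
  using assms(3,4)
proof (induction k)
  case (Suc k)
  then show ?case
    using run_cum_mono_early_step[OF assms(1,2), of k] by (auto simp: le_Suc_eq)
qed simp

lemma run_cum_nonneg_early: "1 < M \<Longrightarrow> 1 \<le> P \<Longrightarrow> k \<le> N \<Longrightarrow> 0 \<le> run_cum P k"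
  using run_cum_mono_early[of P 0 k] by simp

text \<open>A discrete Gronwall estimate: one step multiplies by at most \<open>1 + \<tau>\<close>
  and adds \<open>\<tau> * q\<close>. Up to time 1 this gives \<open>q * (exp 1 - 1)\<close>,
  independently of \<open>\<tau>\<close> and \<open>P\<close>.\<close>

lemma reach_le:
  assumes "1 < M" "1 \<le> P" "P \<le> \<gamma>" "k \<le> N"
  shows "reach P (run_cum P) k \<le> 2 * ((\<gamma> - 1) / (1 - a))"
proof -
  define q where "q = (\<gamma> - 1) / (1 - a)"
  have q: "(P - 1) / (1 - a) \<le> q" using assms a_less_1 by (simp add: q_def divide_right_mono)
  have q0: "0 \<le> q" using gamma_gt_1 a_less_1 by (simp add: q_def)
  have "reach P (run_cum P) k \<le> q * ((1 + \<tau>) ^ k - 1)"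
    using assms(4)
  proof (induction k)
    case (Suc k)
    then have IH: "reach P (run_cum P) k \<le> q * ((1 + \<tau>) ^ k - 1)" by simp
    have "reach P (run_cum P) (Suc k) \<le> reach P (run_cum P) k + \<tau> * (reach P (run_cum P) k + q)"
      using Suc.prems run_cum_le_reach[OF assms(1), of P k] q tau_pos
      by (simp add: reach_Suc add_mono)
    also have "\<dots> = (1 + \<tau>) * reach P (run_cum P) k + \<tau> * q" by (simp add: algebra_simps)
    also have "\<dots> \<le> (1 + \<tau>) * (q * ((1 + \<tau>) ^ k - 1)) + \<tau> * q"
      using IH tau_pos by (intro add_right_mono mult_left_mono) auto
    finally show ?case by (simp add: algebra_simps)
  qed simp
  also have "(1 + \<tau>) ^ k \<le> exp \<tau> ^ k"
    using tau_pos exp_ge_add_one_self[of \<tau>] by (intro power_mono) auto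
  then have "q * ((1 + \<tau>) ^ k - 1) \<le> q * (exp \<tau> ^ k - 1)" using q0 by (intro mult_left_mono) auto
  also have "exp \<tau> ^ k = exp (real k * \<tau>)" by (simp add: exp_of_nat_mult)
  also have "exp (real k * \<tau>) \<le> exp 1" using assms(4) N_tau time_le_iff[of k N] by simp
  then have "q * (exp (real k * \<tau>) - 1) \<le> q * (exp 1 - 1)" using q0 by (intro mult_left_mono) auto
  also have "q * (exp 1 - 1) \<le> q * (3 - 1)" using exp_le q0 by (intro mult_left_mono) auto
  finally show ?thesis unfolding q_def[symmetric] by simp
qed

text \<open>Each step adds at most \<open>\<tau>\<close> times \<open>2 * q\<close> from
  \<open>reach_le\<close> plus \<open>q\<close> from the slope of \<open>cap\<close>, with
  \<open>q = (\<gamma> - 1) / (1 - a)\<close>.\<close>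

lemma reach_diff_le:
  assumes "1 < M" "1 \<le> P" "P \<le> \<gamma>" "d \<le> k" "k \<le> N"
  shows "reach P (run_cum P) k \<le> reach P (run_cum P) (k - d) + real d * \<tau> * (3 * ((\<gamma> - 1) / (1 - a)))"
  using assms(4)
proof (induction d)
  case (Suc d)
  define i where "i = k - Suc d"
  have i: "k - d = Suc i" "i < N" using Suc.prems assms(5) by (auto simp: i_def)
  have "(P - 1) / (1 - a) \<le> (\<gamma> - 1) / (1 - a)" using assms a_less_1 by (simp add: divide_right_mono)
  moreover have "run_cum P i \<le> 2 * ((\<gamma> - 1) / (1 - a))"
    using run_cum_le_reach[OF assms(1), of P i] reach_le[OF assms(1-3), of i] i by simp
  ultimately have "run_cum P i + (P - 1) / (1 - a) \<le> 3 * ((\<gamma> - 1) / (1 - a))" by linarith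
  then have "\<tau> * (run_cum P i + (P - 1) / (1 - a)) \<le> \<tau> * (3 * ((\<gamma> - 1) / (1 - a)))"
    using tau_pos by (intro mult_left_mono) auto
  moreover have "reach P (run_cum P) (Suc i)
      = reach P (run_cum P) i + \<tau> * (run_cum P i + (P - 1) / (1 - a))"
    using i(2) by (simp add: reach_Suc)
  moreover have "reach P (run_cum P) k \<le> reach P (run_cum P) (Suc i) + real d * \<tau> * (3 * ((\<gamma> - 1) / (1 - a)))"
    using Suc i by simp
  moreover have "real (Suc d) * \<tau> * (3 * ((\<gamma> - 1) / (1 - a)))
      = real d * \<tau> * (3 * ((\<gamma> - 1) / (1 - a))) + \<tau> * (3 * ((\<gamma> - 1) / (1 - a)))"
    by (simp only: of_nat_Suc distrib_right mult_1_left add.commute)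
  ultimately show ?case unfolding i_def[symmetric] by linarith
qed simp

text \<open>
  The tail cap is not a constraint at \<open>L\<^sub>3\<close>, so the algorithm must not lose mass there.  If it did,
  the ratio constraint would be slack, hence the tail constraint tight, at all points up to
  \<open>Q ^ n\<close> steps before \<open>L\<^sub>3\<close>.  The bad interval of \<open>L\<^sub>3 - d \<tau>\<close> starts no earlier than \<open>L\<^sub>3 - Q d \<tau>\<close>, so each
  of the intervals between \<open>Q ^ i\<close> and \<open>Q ^ (i + 1)\<close> steps before \<open>L\<^sub>3\<close> would contain mass at least
  \<open>\<delta>\<close>, which together is more than the ratio constraint allows.
\<close>

lemma run_cum_M:
  assumes P: "1 \<le> P" "P \<le> \<gamma>"
    and Q: "1 + (\<gamma> - 1) / (1 - a) \<le> real Q"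
    and n: "2 * ((\<gamma> - 1) / (1 - a)) < real n * \<delta>"
    and small: "Q ^ n < M" "real (Q ^ n) * \<tau> * (3 * ((\<gamma> - 1) / (1 - a))) \<le> \<delta>"
  shows "run_cum P M = reach P (run_cum P) M"
proof (rule ccontr)
  define q where "q = (\<gamma> - 1) / (1 - a)"
  assume neq: "run_cum P M \<noteq> reach P (run_cum P) M"
  have q1: "1 \<le> q" using gamma_ge a_less_1 by (simp add: q_def)
  then have "2 \<le> Q" using Q unfolding q_def[symmetric] by linarith
  then have Q1: "1 \<le> Q ^ i" for i by simp
  have M1: "1 < M" using Q1[of n] small by linarith
  note mono = run_cum_mono_early[OF M1 P(1)]
  \<comment> \<open>The bad interval of L3 is empty, so the cap there only limits the mass at L3
    itself to \<open>\<delta>\<close>. If it is active, the ratio bound lies strictly above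
    it.\<close>
  have "\<delta> + run_cum P (M - 1) < reach P (run_cum P) M"
  proof -
    have "min (low M) (M - 1) = M - 1" using low_less_self_iff[of M] M_le_N N_le_I M1 by linarith
    then show ?thesis using neq run_cum_head[of "M - 1" P] M1 M_le_N by (auto split: if_splits)
  qed
  moreover have tight: "\<delta> + run_cum P (M - Q * d) \<le> run_cum P (M - d)"
    if gap: "\<delta> + run_cum P (M - 1) < reach P (run_cum P) M" and d: "1 \<le> d" "d \<le> Q ^ n" for d
  proof -
    have dM: "d < M" using d small by linarith
    \<comment> \<open>Within \<open>Q ^ n\<close> steps the ratio bound drops by at most
      \<open>\<delta>\<close>, so the gap at \<open>M\<close> keeps it slack at
      \<open>M - d\<close>.\<close>
    have "real d * \<tau> * (3 * q) \<le> real (Q ^ n) * \<tau> * (3 * q)"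
      using d tau_pos q1 by (intro mult_right_mono) auto
    then have "reach P (run_cum P) M \<le> reach P (run_cum P) (M - d) + \<delta>"
      using reach_diff_le[OF M1 P, of d M] dM M_le_N small unfolding q_def by linarith
    moreover have "run_cum P (M - d) \<le> run_cum P (M - 1)" using d M_le_N by (intro mono) auto
    ultimately have "run_cum P (M - d) \<noteq> reach P (run_cum P) (M - d)" using gap by linarith
    moreover have "M - d = Suc (M - d - 1)" using dM by simp
    ultimately have e: "run_cum P (M - d) = \<delta> + run_cum P (min (low (M - d)) (M - d - 1))"
      using run_cum_head[of "M - d - 1" P] M1 M_le_N d dM by (auto simp: min_def split: if_splits)
    have low: "M - Q * d \<le> low (M - d)"
    proof (cases "Q * d < M")
      case True
      \<comment> \<open>\<open>low_time\<close> fixes L3 and has slope \<open>1 + q\<close> before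
        time 1, whence the lower bound required of \<open>Q\<close>.\<close>
      have "real M * \<tau> * q = 1" using M_tau gamma_gt_1 a_less_1 by (simp add: L3_def q_def)
      moreover have "low_time (M - d) = (real M - real d) * \<tau> - 1 + (real M - real d) * \<tau> * q"
      proof -
        have "M - d \<le> N" using M_le_N by simp
        then show ?thesis using dM by (simp add: low_time_def of_nat_diff q_def)
      qed
      ultimately have "low_time (M - d) = real M * \<tau> - real d * (1 + q) * \<tau>"
        by (simp add: algebra_simps)
      moreover have "real d * (1 + q) * \<tau> \<le> real d * real Q * \<tau>"
        using Q tau_pos by (intro mult_right_mono mult_left_mono) (auto simp: q_def)
      ultimately have "real (M - Q * d) * \<tau> \<le> low_time (M - d)"
        using True by (simp add: of_nat_diff algebra_simps)
      then show ?thesis using True by (subst le_low_iff) auto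
    qed simp
    have "d + 1 \<le> Q * d" using \<open>2 \<le> Q\<close> d mult_le_mono1[of 2 Q d] by linarith
    then have "M - Q * d \<le> M - d - 1" by linarith
    with low have "run_cum P (M - Q * d) \<le> run_cum P (min (low (M - d)) (M - d - 1))"
      using M_le_N by (intro mono) auto
    with e show ?thesis by simp
  qed
  ultimately have tight: "\<delta> + run_cum P (M - Q * d) \<le> run_cum P (M - d)" if "1 \<le> d" "d \<le> Q ^ n" for d
    using that by blast
  have "real i * \<delta> + run_cum P (M - Q ^ i) \<le> run_cum P (M - 1)" if "i \<le> n" for i
    using that
  proof (induction i)
    case (Suc i)
    have "Q ^ i \<le> Q ^ n" using Suc.prems \<open>2 \<le> Q\<close> by (intro power_increasing) auto
    then have "\<delta> + run_cum P (M - Q ^ Suc i) \<le> run_cum P (M - Q ^ i)"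
      using tight[of "Q ^ i"] Q1[of i] by simp
    then show ?case using Suc by (simp add: algebra_simps)
  qed simp
  from this[of n] have "real n * \<delta> \<le> run_cum P (M - 1)"
    using run_cum_nonneg_early[OF M1 P(1), OF le_trans[OF diff_le_self M_le_N], of "Q ^ n"] by simp
  also have "\<dots> \<le> 2 * q"
    using run_cum_le_reach[OF M1, of P "M - 1"] reach_le[OF M1 P le_trans[OF diff_le_self M_le_N], of 1]
    unfolding q_def by simp
  finally show False using n by (simp add: q_def)
qed

subsection \<open>Domination and optimality\<close>

text \<open>Along a constant \<open>c \<ge> kappa P\<close> the ratio bound grows by
  \<open>\<tau> * (c - kappa P)\<close> per step. So a cumulative function that stays constant from
  \<open>m\<close> on needs the ratio check only up to \<open>m\<close>.\<close>

lemma reach_ge_const: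
  assumes "N \<le> m" "\<And>j. m \<le> j \<Longrightarrow> V j = c" "kappa P \<le> c" "c \<le> reach P V m" "m \<le> k"
  shows "c \<le> reach P V k"
  using assms(5)
proof (induction k)
  case (Suc k)
  show ?case
  proof (cases "m \<le> k")
    case True
    have "0 \<le> \<tau> * (V k - kappa P)" using assms(2,3) True tau_pos by simp
    then show ?thesis using Suc.IH True assms(1) by (simp add: reach_Suc)
  next
    case False
    then have "Suc k = m" using Suc.prems by simp
    then show ?thesis using assms(4) by simp
  qed
qed (use assms(4) in simp)

lemma kappa_le_1: "1 \<le> P \<Longrightarrow> kappa P \<le> 1"
  using a_less_1 a_nonneg mult_left_mono[of 1 P a] by (simp add: kappa_def)

text \<open>The common route from cumulative functions to distributions: it serves the point mass at
  L3, the scaled masses, and both outputs of the algorithm.\<close>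

lemma feasible_of_cum:
  assumes "V 0 = 0" "mono V" "\<And>k. n \<le> k \<Longrightarrow> V k = V n" "V n \<le> 1" "1 \<le> P"
    and ratio: "\<And>k. 0 < k \<Longrightarrow> V k \<le> reach P V k"
    and tail: "\<And>k. 0 < k \<Longrightarrow> k \<le> L \<Longrightarrow> V k \<le> \<delta> + V (min (low k) k)" "1 - V B \<le> \<delta>"
    and inf: "(1 - V n) * (1 - a) \<le> a * (P - 1)"
  shows "\<exists>f. (\<forall>j. pmf f (enat j) = V j - V (j - 1)) \<and> pmf f \<infinity> = 1 - V n \<and>
    feasible a \<gamma> \<delta> \<tau> f \<and> worst_ratio a \<tau> f \<le> ennreal P"
proof -
  obtain f where f: "set_pmf f \<subseteq> {1..}" "\<forall>j. pmf f (enat j) = V j - V (j - 1)"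
      "pmf f \<infinity> = 1 - V n" "cum f = V"
    using ex_pmf_cum[OF assms(1-4)] by blast
  have "cum f k - cum f (min (low k) k) \<le> \<delta>" if "k \<in> {1..L}" for k
    using tail(1)[of k] that unfolding f(4) by auto
  then have "feasible a \<gamma> \<delta> \<tau> f"
    using f(1) tail(2) unfolding feasible_iff f(4) by simp
  moreover have "worst_ratio a \<tau> f \<le> ennreal P"
    using f(1) assms(5) ratio inf by (intro worst_ratio_le) (simp_all add: f(3,4))
  ultimately show ?thesis using f(2,3) by blast
qed

lemma tail_trivial:
  fixes V :: "nat \<Rightarrow> real"
  assumes "0 < k" "M \<le> k" "k \<le> I"
  shows "V k \<le> \<delta> + V (min (low k) k)"
proof -
  have "k \<le> low k" using assms low_less_self_iff[of k] by linarith
  then show ?thesis using delta_nonneg by (simp add: min_absorb2)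
qed

text \<open>After time 1 the bad interval starts at or after time 1, where \<open>V\<close> no
  longer changes.\<close>

lemma tail_const:
  fixes V :: "nat \<Rightarrow> real"
  assumes "N < k" "\<And>j. N \<le> j \<Longrightarrow> V j = c"
  shows "V k \<le> \<delta> + V (min (low k) k)"
  using assms(2)[of k] assms(2)[of "min (low k) k"] assms(1) N_le_low[OF assms(1)] delta_nonneg by simp

lemma ex_feasible_gamma: "\<exists>f. feasible a \<gamma> \<delta> \<tau> f \<and> worst_ratio a \<tau> f \<le> ennreal \<gamma>"
proof -
  \<comment> \<open>The point mass at L3: at that stopping time the ratio is exactly
    \<open>\<gamma>\<close>, and the tail constraint is vacuous.\<close>
  define V where "V k = (if M \<le> k then 1 else 0 :: real)" for k
  have reach_nonneg: "0 \<le> reach \<gamma> V k" if "k \<le> N" for k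
    unfolding reach_def cap_def using that tau_pos gamma_gt_1 a_less_1
    by (auto intro!: add_nonneg_nonneg mult_nonneg_nonneg divide_nonneg_nonneg sum_nonneg simp: V_def)
  have ratio_early: "V k \<le> reach \<gamma> V k" if "k \<le> N" for k
  proof (cases "M \<le> k")
    case True
    have "(1 - a) \<le> real k * \<tau> * (\<gamma> - 1)"
      using True M_tau gamma_gt_1 time_le_iff[of M k] by (simp add: L3_def pos_divide_le_eq)
    then have "1 \<le> cap \<gamma> k" using that a_less_1 by (simp add: cap_def pos_le_divide_eq)
    moreover have "0 \<le> \<tau> * (\<Sum>j<k. V j)"
      using tau_pos by (intro mult_nonneg_nonneg sum_nonneg) (auto simp: V_def)
    ultimately show ?thesis using True by (simp add: reach_def V_def)
  next
    case False
    then show ?thesis using reach_nonneg[OF that] by (simp add: V_def)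
  qed
  have late: "V k = 1" if "N \<le> k" for k
    using that M_le_N by (simp add: V_def)
  have "\<exists>f. (\<forall>j. pmf f (enat j) = V j - V (j - 1)) \<and> pmf f \<infinity> = 1 - V N \<and>
      feasible a \<gamma> \<delta> \<tau> f \<and> worst_ratio a \<tau> f \<le> ennreal \<gamma>"
  proof (rule feasible_of_cum)
    show "V 0 = 0" using M_pos by (simp add: V_def)
    show "mono V" by (auto simp: V_def mono_def)
    show "1 \<le> \<gamma>" using gamma_gt_1 by simp
    show "V k = V N" if "N \<le> k" for k using that late by simp
    show "V k \<le> reach \<gamma> V k" for k
    proof (cases "k \<le> N")
      case False
      then have "1 \<le> reach \<gamma> V k"
        using reach_ge_const[of N V 1 \<gamma> k] late ratio_early[of N] kappa_le_1 gamma_gt_1 by simp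
      then show ?thesis using False late by simp
    qed (rule ratio_early)
    show "V k \<le> \<delta> + V (min (low k) k)" if "0 < k" for k
    proof -
      consider "k < M" | "M \<le> k" "k \<le> N" | "N < k" by linarith
      then show ?thesis
      proof cases
        case 1
        then show ?thesis using delta_nonneg by (simp add: V_def)
      next
        case 2
        then show ?thesis using tail_trivial[of k V] that N_le_I by simp
      next
        case 3
        then show ?thesis using tail_const[of k V 1] late by simp
      qed
    qed
    show "1 - V B \<le> \<delta>" using late[OF N_le_B] delta_nonneg by simp
    show "(1 - V N) * (1 - a) \<le> a * (\<gamma> - 1)"
      using late[of N] a_nonneg gamma_gt_1 by simp
  qed (simp add: V_def)
  then show ?thesis by blast
qed

lemma one_le_worst_ratio: "1 \<le> worst_ratio a \<tau> f"
  unfolding worst_ratio_def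
  by (rule SUP_upper2[of \<infinity>]) (auto simp: one_le_expected_ratio_infinity)

section \<open>Error terms for distributions of value at most \<open>P + \<epsilon>\<close>\<close>

lemma sum_geometric: "\<tau> * (\<Sum>j<k. (1 + \<tau>) ^ j) = (1 + \<tau>) ^ k - 1"
  by (induction k) (auto simp: algebra_simps)

lemma cap_add_le:
  assumes "0 \<le> \<epsilon>" "k \<le> n"
  shows "cap (P + \<epsilon>) k \<le> cap P k + \<epsilon> * ((1 + real n * \<tau>) / (1 - a))"
proof -
  have kn: "real k * \<tau> \<le> real n * \<tau>" using assms(2) by (simp add: time_le_iff)
  have k0: "0 \<le> real k * \<tau>" using tau_pos by simp
  have "a * (real k * \<tau>) \<le> 1 * (real k * \<tau>)"
    using a_less_1 k0 by (intro mult_right_mono) auto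
  then have c: "c \<le> 1 + real n * \<tau>" if "c = (if k \<le> N then real k * \<tau> else 1 - a + a * (real k * \<tau>))" for c
    using that kn a_nonneg by (auto split: if_splits)
  have "cap (P + \<epsilon>) k = cap P k + \<epsilon> * ((if k \<le> N then real k * \<tau> else 1 - a + a * (real k * \<tau>)) / (1 - a))"
    by (auto simp: cap_def algebra_simps simp flip: add_divide_distrib diff_divide_distrib)
  also have "\<dots> \<le> cap P k + \<epsilon> * ((1 + real n * \<tau>) / (1 - a))"
    using c assms(1) a_less_1 by (intro add_left_mono mult_left_mono divide_right_mono) auto
  finally show ?thesis .
qed

end

lemma le_of_le_add_eps_mult:
  fixes x y c :: real
  assumes "0 < c" "\<And>\<epsilon>. 0 < \<epsilon> \<Longrightarrow> x \<le> y + \<epsilon> * c"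
  shows "x \<le> y"
proof (rule field_le_epsilon)
  fix e :: real assume "0 < e"
  then show "x \<le> y + e" using assms(2)[of "e / c"] assms(1) by simp
qed

text \<open>\<open>approx\<close> and \<open>minimal\<close> say that \<open>P\<close> is the
  infimum. A small step is needed only to establish \<open>M_gt_1\<close> and
  \<open>tight_M\<close>.\<close>

locale ski_greedy = ski_grid +
  fixes P :: real
  assumes P_ge_1: "1 \<le> P" and M_gt_1: "1 < M"
    and tight_M: "run_cum P M = reach P (run_cum P) M"
    and approx: "0 < \<epsilon> \<Longrightarrow> \<exists>g. feasible a \<gamma> \<delta> \<tau> g \<and> worst_ratio a \<tau> g \<le> ennreal (P + \<epsilon>)"
    and minimal: "feasible a \<gamma> \<delta> \<tau> g \<Longrightarrow> ennreal P \<le> worst_ratio a \<tau> g"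
begin

abbreviation U :: "nat \<Rightarrow> real" where
  "U \<equiv> run_cum P"

lemmas U_head = run_cum_head[OF _ M_gt_1, of _ P]
lemmas U_late = run_cum_late[of _ P]
lemmas U_le_reach = run_cum_le_reach[OF M_gt_1, of P]
lemmas U_mono_early = run_cum_mono_early[OF M_gt_1 P_ge_1]

text \<open>
  The error term makes it unnecessary to know that the infimum defining the optimal value is
  attained: for fixed \<open>k\<close> it vanishes as \<open>\<epsilon>\<close> tends to \<open>0\<close>.
\<close>

lemma cum_le_run_cum:
  assumes g: "feasible a \<gamma> \<delta> \<tau> g" "worst_ratio a \<tau> g \<le> ennreal (P + \<epsilon>)"
    and "0 \<le> \<epsilon>" "k \<le> n"
  shows "cum g k \<le> U k + \<epsilon> * ((1 + real n * \<tau>) / (1 - a)) * (1 + \<tau>) ^ k"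
  using assms(4)
proof (induction k rule: less_induct)
  case (less k)
  define K where "K = \<epsilon> * ((1 + real n * \<tau>) / (1 - a))"
  have K0: "0 \<le> K" unfolding K_def using assms(3) a_less_1 tau_pos
    by (intro mult_nonneg_nonneg divide_nonneg_nonneg add_nonneg_nonneg) auto
  have IH: "cum g j \<le> U j + K * (1 + \<tau>) ^ j" if "j < k" for j
    using less that by (simp add: K_def)
  have E_mono: "K * (1 + \<tau>) ^ j \<le> K * (1 + \<tau>) ^ k" if "j \<le> k" for j
    using K0 that tau_pos by (intro mult_left_mono power_increasing) auto
  have supp: "set_pmf g \<subseteq> {1..}" using g(1) by (simp add: feasible_def)
  show ?case
  proof (cases k)
    case 0
    then show ?thesis using K0 by (simp add: K_def)
  next
    case (Suc i)
    have ratio: "cum g k \<le> reach P U k + K * (1 + \<tau>) ^ k"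
    proof -
      have "expected_ratio a \<tau> g (enat k) \<le> worst_ratio a \<tau> g"
        unfolding worst_ratio_def using Suc by (intro SUP_upper) (auto simp: one_enat_def)
      then have "expected_ratio a \<tau> g (enat k) \<le> ennreal (P + \<epsilon>)"
        using g(2) by (rule order_trans)
      then have "cum g k \<le> reach (P + \<epsilon>) (cum g) k"
        using Suc supp P_ge_1 assms(3) by (subst (asm) expected_ratio_le_iff) auto
      also have "\<dots> \<le> (cap P k + K) + \<tau> * (\<Sum>j<k. U j + K * (1 + \<tau>) ^ j)"
        unfolding reach_def K_def using less.prems assms(3) tau_pos IH
        by (intro add_mono cap_add_le mult_left_mono sum_mono) (auto simp: K_def)
      \<comment> \<open>The errors \<open>K * (1 + \<tau>) ^ k\<close> solve the recursion in which
        each equals \<open>K\<close> plus \<open>\<tau>\<close> times the sum of the earlier ones,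
        so the induction reproduces them.\<close>
      also have "\<dots> = reach P U k + K * (1 + \<tau> * (\<Sum>j<k. (1 + \<tau>) ^ j))"
        by (simp add: reach_def sum.distrib sum_distrib_left algebra_simps)
      also have "\<dots> = reach P U k + K * (1 + \<tau>) ^ k"
        by (simp add: sum_geometric)
      finally show ?thesis .
    qed
    have tail: "cum g k \<le> \<delta> + U (min (low k) i) + K * (1 + \<tau>) ^ k" if "k \<le> L" "k < M \<or> I < k"
    proof -
      have lk: "low k < k" using low_less_self_iff that Suc by simp
      have "cum g k \<le> \<delta> + cum g (low k)"
      proof -
        have "cum g k - cum g (min (low k) k) \<le> \<delta>"
          using g(1) that(1) Suc unfolding feasible_iff by auto
        then show ?thesis using lk by (simp add: min_absorb1)
      qed
      then show ?thesis using IH[OF lk] E_mono[of "low k"] lk Suc by (simp add: min_absorb1)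
    qed
    have "cum g k \<le> U k + K * (1 + \<tau>) ^ k"
    proof (cases "k \<le> N")
      case True
      \<comment> \<open>At \<open>k = M\<close> the tail constraint does not restrict
        \<open>g\<close>, so the comparison there rests on \<open>tight_M\<close>.\<close>
      then have "k < M \<or> U k = reach P U k \<or> k = M" using U_head[of i] Suc by (auto split: if_splits)
      then show ?thesis
      proof (elim disjE)
        assume "k < M"
        then have "U k = min (\<delta> + U (min (low k) i)) (reach P U k)"
          using U_head[of i] Suc True by simp
        moreover have "k \<le> L" using True N_le_I I_less_L by simp
        ultimately show ?thesis using tail ratio \<open>k < M\<close> by (simp add: min_def)
      qed (use ratio tight_M in auto)
    next
      case False
      have late: "cum g k \<le> \<delta> + U B + K * (1 + \<tau>) ^ k" if "L < k"
      proof -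
        have "cum g k \<le> \<delta> + cum g B" using g(1) cum_le_1[OF supp, of k] unfolding feasible_iff by linarith
        then show ?thesis using IH[of B] E_mono[of B] that B_less_L by simp
      qed
      show ?thesis
        using U_late[of i] False Suc ratio tail late I_less_L by (auto simp: min_def split: if_splits)
    qed
    then show ?thesis by (simp add: K_def)
  qed
qed

text \<open>A lower bound shared by all feasible distributions passes to the greedy masses by
  domination, letting \<open>\<epsilon>\<close> tend to 0.\<close>

lemma le_run_cumI:
  assumes "\<And>g. feasible a \<gamma> \<delta> \<tau> g \<Longrightarrow> x \<le> cum g k"
  shows "x \<le> U k"
proof (rule le_of_le_add_eps_mult)
  show "0 < (1 + real k * \<tau>) / (1 - a) * (1 + \<tau>) ^ k"
    using tau_pos a_less_1 by (intro mult_pos_pos divide_pos_pos zero_less_power) (auto intro: add_pos_nonneg)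
  fix \<epsilon> :: real assume "0 < \<epsilon>"
  then obtain g where g: "feasible a \<gamma> \<delta> \<tau> g" "worst_ratio a \<tau> g \<le> ennreal (P + \<epsilon>)"
    using approx by blast
  then show "x \<le> U k + \<epsilon> * ((1 + real k * \<tau>) / (1 - a) * (1 + \<tau>) ^ k)"
    using assms[OF g(1)] cum_le_run_cum[OF g, of k k] \<open>0 < \<epsilon>\<close> by (simp add: mult.assoc)
qed

text \<open>Not visible from the recurrence, whose late increments could still be negative at this
  stage.\<close>

lemma U_nonneg: "0 \<le> U k"
  by (intro le_run_cumI cum_nonneg)

lemma U_B: "1 - \<delta> \<le> U B"
  by (intro le_run_cumI) (auto simp: feasible_iff)

lemma U_N: "U N = reach P U N"
proof (cases "M = N")
  case False
  then show ?thesis using U_head[of "N - 1"] M_le_N N_pos by auto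
qed (use tight_M in simp)

text \<open>As long as \<open>U\<close> stays at or below \<open>U N\<close>, each late step lowers
  the bound by at least \<open>\<tau> * (kappa P - U N)\<close>. A strict inequality would thus
  drive \<open>U\<close> below 0; equality bounds \<open>U\<close> by
  \<open>kappa P\<close>.\<close>

lemma reach_late_le:
  assumes "U N \<le> kappa P"
  shows "reach P U (N + d) \<le> U N - real d * (\<tau> * (kappa P - U N))"
proof (induction d)
  case (Suc d)
  have "0 \<le> real d * (\<tau> * (kappa P - U N))" using assms tau_pos by simp
  then have "U (N + d) - kappa P \<le> - (kappa P - U N)" using U_le_reach[of "N + d"] Suc by linarith
  then have "\<tau> * (U (N + d) - kappa P) \<le> \<tau> * - (kappa P - U N)"
    using tau_pos by (intro mult_left_mono) auto
  then show ?case using Suc by (simp add: reach_Suc algebra_simps)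
qed (simp flip: U_N)

lemma kappa_le_U_N: "kappa P \<le> U N"
proof (rule ccontr)
  assume "\<not> kappa P \<le> U N"
  then have less: "U N < kappa P" by simp
  then have "0 < \<tau> * (kappa P - U N)" using tau_pos by simp
  then obtain d where "U N < real d * (\<tau> * (kappa P - U N))"
    using reals_Archimedean3 by blast
  then have "U (N + d) < 0"
    using reach_late_le[of d] less U_le_reach[of "N + d"] by linarith
  then show False using U_nonneg[of "N + d"] by simp
qed

text \<open>Otherwise scaling the masses down to total mass 1 gives a value less than \<open>P\<close>.\<close>

lemma U_N_le_1: "U N \<le> 1"
proof (rule ccontr)
  assume "\<not> U N \<le> 1"
  then have gt: "1 < U N" by simp
  define \<theta> where "\<theta> = 1 / U N"
  have th: "0 < \<theta>" "\<theta> < 1" "\<theta> * U N = 1" using gt by (auto simp: \<theta>_def)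
  \<comment> \<open>Scaling improves the value only if \<open>P > 1\<close>. For
    \<open>P = 1\<close> all early caps vanish, hence so do the masses.\<close>
  have "P \<noteq> 1"
  proof
    assume "P = 1"
    then have cap: "cap P k = 0" if "k \<le> N" for k using that by (simp add: cap_def)
    have "U k \<le> 0" if "k \<le> N" for k
      using that
    proof (induction k rule: less_induct)
      case (less k)
      then have "\<tau> * (\<Sum>j<k. U j) \<le> 0"
        using tau_pos by (intro mult_nonneg_nonpos sum_nonpos) auto
      then show ?case using U_le_reach[of k] cap less.prems by (simp add: reach_def)
    qed
    then show False using gt by force
  qed
  then have "1 < P" using P_ge_1 by simp
  \<comment> \<open>Chosen such that \<open>cap P' k = \<theta> * cap P k\<close> for
    \<open>k \<le> N\<close>.\<close>
  define P' where "P' = 1 + \<theta> * (P - 1)"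
  have "\<theta> * (P - 1) < 1 * (P - 1)"
    using th \<open>1 < P\<close> by (intro mult_strict_right_mono) auto
  then have P': "P' < P" "1 \<le> P'"
    using th \<open>1 < P\<close> unfolding P'_def mult_1 by (linarith, simp)
  define V where "V k = (if k \<le> N then \<theta> * U k else 1)" for k
  have late: "V k = 1" if "N \<le> k" for k using that th by (auto simp: V_def)
  have early: "V k \<le> reach P' V k" if "k \<le> N" for k
  proof -
    have "\<theta> * U k \<le> \<theta> * reach P U k" using th U_le_reach by (intro mult_left_mono) auto
    also have "\<dots> = cap P' k + \<tau> * (\<Sum>j<k. \<theta> * U j)"
      using that by (simp add: reach_def cap_def P'_def sum_distrib_left algebra_simps)
    also have "(\<Sum>j<k. \<theta> * U j) = (\<Sum>j<k. V j)" using that by (intro sum.cong) (auto simp: V_def)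
    finally show ?thesis using that by (simp add: reach_def V_def)
  qed
  have mono: "mono V"
  proof (rule monoI)
    fix j k :: nat assume jk: "j \<le> k"
    show "V j \<le> V k"
    proof (cases "k \<le> N")
      case True
      then show ?thesis using th jk U_mono_early[OF jk True] by (simp add: V_def)
    next
      case False
      have "\<theta> * U j \<le> \<theta> * U N" if "j \<le> N"
        using th U_mono_early[OF that] by (intro mult_left_mono) auto
      then show ?thesis using False th by (auto simp: V_def)
    qed
  qed
  have "\<exists>f. (\<forall>j. pmf f (enat j) = V j - V (j - 1)) \<and> pmf f \<infinity> = 1 - V N \<and>
      feasible a \<gamma> \<delta> \<tau> f \<and> worst_ratio a \<tau> f \<le> ennreal P'"
  proof (rule feasible_of_cum)
    show "V k = V N" if "N \<le> k" for k using that late by simp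
    show "V k \<le> reach P' V k" for k
    proof (cases "k \<le> N")
      case False
      then have "1 \<le> reach P' V k"
        using reach_ge_const[of N V 1 P' k] late early[of N] kappa_le_1 P' by simp
      then show ?thesis using False late by simp
    qed (rule early)
    show "V k \<le> \<delta> + V (min (low k) k)" if k0: "0 < k" for k
    proof -
      consider "k < M" | "M \<le> k" "k \<le> N" | "N < k" by linarith
      then show ?thesis
      proof cases
        case 1
        then obtain i where i: "k = Suc i" using k0 by (cases k) auto
        have kN: "k \<le> N" using 1 M_le_N by simp
        have "low k < k" using low_less_self_iff[of k] 1 k0 by simp
        then have "min (low k) k = min (low k) i" using i by simp
        then have "U k \<le> \<delta> + U (min (low k) k)" using U_head[of i] i 1 kN by simp
        then have "\<theta> * U k \<le> \<theta> * (\<delta> + U (min (low k) k))" using th by (intro mult_left_mono) auto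
        moreover have "\<theta> * \<delta> \<le> 1 * \<delta>" using th delta_nonneg by (intro mult_right_mono) auto
        moreover have "min (low k) k \<le> N" using kN by simp
        ultimately show ?thesis using kN by (simp add: V_def algebra_simps)
      next
        case 2
        then show ?thesis using tail_trivial[of k V] k0 N_le_I by simp
      next
        case 3
        then show ?thesis using tail_const[of k V 1] late by simp
      qed
    qed
    show "1 - V B \<le> \<delta>" using late[OF N_le_B] delta_nonneg by simp
    show "(1 - V N) * (1 - a) \<le> a * (P' - 1)"
      using late[of N] a_nonneg P' by simp
    show "V 0 = 0" by (simp add: V_def)
    show "V N \<le> 1" using late[of N] by simp
  qed (fact mono P')+
  then obtain f where "feasible a \<gamma> \<delta> \<tau> f" "worst_ratio a \<tau> f \<le> ennreal P'" by blast
  then have "ennreal P \<le> ennreal P'" using minimal order_trans by blast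
  then show False using P' by (simp add: ennreal_le_iff)
qed

text \<open>Once \<open>kappa P \<le> U k\<close>, the ratio bound does not decrease. It remains
  that \<open>U k\<close> respects the tail bound of the next point, including where one step of the
  algorithm hands over to the next.\<close>

lemma U_mono_late_step:
  assumes "N \<le> k"
  shows "kappa P \<le> U k \<and> U k \<le> U (Suc k)"
  using assms
proof (induction k rule: less_induct)
  case (less k)
  have step: "U i \<le> U (Suc i)" if "i < k" for i
  proof (cases "N \<le> i")
    case True
    then show ?thesis using less.IH that by simp
  next
    case False
    then show ?thesis by (intro U_mono_early) auto
  qed
  have mono: "U i \<le> U j" if "i \<le> j" "j \<le> k" for i j
    using that
  proof (induction j)
    case (Suc j)
    then show ?case using step[of j] by (cases "i \<le> j") (auto simp: le_Suc_eq)
  qed simp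
  have kappa: "kappa P \<le> U k"
    using kappa_le_U_N mono[of N k] less.prems by simp
  have r: "U k \<le> reach P U (Suc k)"
  proof -
    have "0 \<le> \<tau> * (U k - kappa P)" using kappa tau_pos by simp
    then show ?thesis using U_le_reach[of k] less.prems by (simp add: reach_Suc)
  qed
  have t: "U k \<le> \<delta> + U (min (low (Suc k)) k)" if "I < Suc k" "Suc k \<le> L"
  proof (cases "k \<le> low (Suc k)")
    case True
    then show ?thesis using delta_nonneg by (simp add: min_absorb2)
  next
    case False
    \<comment> \<open>The first point with a tail cap, \<open>Suc I\<close>, has its bad interval
      starting at or after \<open>I\<close>, so it belongs to the previous case.\<close>
    then have "k \<noteq> I" using I_le_low[of "Suc k"] by auto
    then have Ik: "I < k" using that by simp
    then obtain i where i: "k = Suc i" by (cases k) auto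
    have Ni: "N \<le> i" using Ik i N_le_I by simp
    have "U k \<le> \<delta> + U (min (low k) i)"
      using U_late[OF Ni] Ik that i by simp
    also have "U (min (low k) i) \<le> U (min (low (Suc k)) k)"
      using low_mono_late[of k "Suc k"] Ni i by (intro mono) auto
    finally show ?thesis by simp
  qed
  have l: "U k \<le> \<delta> + U B" if "L < Suc k"
  proof -
    obtain i where i: "k = Suc i" using less.prems N_pos by (cases k) auto
    have Ni: "N \<le> i" using that i N_le_I I_less_L by linarith
    show ?thesis
    proof (cases "k = L")
      case True
      \<comment> \<open>Since \<open>low L = B\<close>, the last tail cap of step (vi) coincides
        with the cap of step (vii).\<close>
      have "low k \<le> i" using True low_L B_less_L i by simp
      then show ?thesis using U_late[OF Ni] True i I_less_L low_L by (simp add: min_absorb1)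
    next
      case False
      then show ?thesis using U_late[OF Ni] that i I_less_L by simp
    qed
  qed
  show ?case using kappa r t l U_late[OF less.prems] I_less_L by auto
qed

lemma U_mono: "mono U"
proof (rule mono_iff_le_Suc[THEN iffD2], intro allI)
  fix k
  show "U k \<le> U (Suc k)"
    using U_mono_late_step[of k] U_mono_early[of k "Suc k"] by (cases "N \<le> k") auto
qed

lemma U_tail:
  assumes "0 < k" "k \<le> L"
  shows "U k \<le> \<delta> + U (min (low k) k)"
proof (cases "low k < k")
  case True
  then obtain i where i: "k = Suc i" by (cases k) auto
  with True have m: "min (low k) k = min (low k) i" by simp
  have "k < M \<or> I < k" using True low_less_self_iff assms by simp
  then show ?thesis
    using U_head[of i] U_late[of i] m i M_le_N N_le_I assms by (auto split: if_splits)
next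
  case False
  then show ?thesis using delta_nonneg by (simp add: min_absorb2)
qed

lemma U_le_1_early: "k \<le> N \<Longrightarrow> U k \<le> 1"
  using U_mono_early[of k N] U_N_le_1 by simp

section \<open>The distributions returned by the algorithm\<close>

lemma ex_pmf_kappa:
  assumes "U N = kappa P"
  shows "\<exists>f. pmf f = (run P N)(\<infinity> := 1 - kappa P) \<and>
    feasible a \<gamma> \<delta> \<tau> f \<and> worst_ratio a \<tau> f \<le> ennreal P"
proof -
  define V where "V k = U (min k N)" for k
  have late: "V k = kappa P" if "N \<le> k" for k using that assms by (simp add: V_def min_absorb2)
  have reach_eq: "reach P V k = reach P U k" if "k \<le> N" for k
    using that by (simp add: reach_def V_def)
  have early: "V k \<le> reach P V k" if "k \<le> N" for k
    using that U_le_reach[of k] by (simp add: reach_eq) (simp add: V_def)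
  have "\<exists>f. (\<forall>j. pmf f (enat j) = V j - V (j - 1)) \<and> pmf f \<infinity> = 1 - V N \<and>
      feasible a \<gamma> \<delta> \<tau> f \<and> worst_ratio a \<tau> f \<le> ennreal P"
  proof (rule feasible_of_cum)
    show "mono V" using U_mono by (auto simp: V_def mono_def)
    show "V k = V N" if "N \<le> k" for k using that late by simp
    show "V N \<le> 1" using U_N_le_1 by (simp add: V_def)
    show "V k \<le> reach P V k" for k
    proof (cases "k \<le> N")
      case False
      then have "kappa P \<le> reach P V k"
        using reach_ge_const[of N V "kappa P" P k] late early[of N] by simp
      then show ?thesis using False late by simp
    qed (rule early)
    show "V k \<le> \<delta> + V (min (low k) k)" if "0 < k" "k \<le> L" for k
    proof (cases "k \<le> N")
      case True
      then have "min k N = k" "min (min (low k) k) N = min (low k) k" by auto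
      then show ?thesis using U_tail[OF that] by (simp only: V_def)
    next
      case False
      then show ?thesis using tail_const[of k V "kappa P"] late by simp
    qed
    \<comment> \<open>Although nothing is bought after time 1, the tail constraint at
      \<open>B\<close> holds: the uncut masses satisfy \<open>1 - \<delta> \<le> U B\<close> by
      domination, and \<open>U B \<le> kappa P\<close>.\<close>
    have "reach P U (N + (B - N)) \<le> U N"
      using reach_late_le[of "B - N"] assms by simp
    then have "U B \<le> kappa P" using U_le_reach[of B] N_le_B assms by simp
    then show "1 - V B \<le> \<delta>" using U_B late[OF N_le_B] by simp
    have "kappa P * (1 - a) = 1 - a * P" using a_less_1 by (simp add: kappa_def)
    then show "(1 - V N) * (1 - a) \<le> a * (P - 1)"
      using late[of N] by (simp add: algebra_simps)
  qed (use P_ge_1 in \<open>auto simp: V_def\<close>)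
  then obtain f where f: "\<forall>j. pmf f (enat j) = V j - V (j - 1)" "pmf f \<infinity> = 1 - V N"
    "feasible a \<gamma> \<delta> \<tau> f" "worst_ratio a \<tau> f \<le> ennreal P" by blast
  have "pmf f t = ((run P N)(\<infinity> := 1 - kappa P)) t" for t
  proof (cases t)
    case (enat j)
    consider "j \<le> N" | "N < j" by linarith
    then show ?thesis
    proof cases
      case 1
      then have "min j N = j" "min (j - 1) N = j - 1" by auto
      then show ?thesis using 1 enat f(1) by (simp add: V_def run_eq_diff)
    next
      case 2
      then have "N \<le> j - 1" "N \<le> j" by auto
      then show ?thesis using 2 enat f(1) late by (simp add: run_outside)
    qed
  next
    case infinity
    then show ?thesis using f(2) late[of N] by simp
  qed
  with f show ?thesis by (intro exI[of _ f]) auto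
qed

lemma ex_U_ge_1:
  assumes "kappa P < U N"
  shows "\<exists>k>N. 1 \<le> U k"
proof (rule ccontr)
  assume "\<not> ?thesis"
  then have less: "U k < 1" if "N < k" for k using that by force
  define c where "c = \<tau> * (U N - kappa P)"
  have c: "0 < c" using assms tau_pos by (simp add: c_def)
  have grow: "U N + real d * c \<le> reach P U (N + d)" for d
  proof (induction d)
    case (Suc d)
    have "U N \<le> U (N + d)" using U_mono by (simp add: mono_def)
    then have "c \<le> \<tau> * (U (N + d) - kappa P)"
      unfolding c_def using tau_pos by (intro mult_left_mono) auto
    then show ?case using Suc by (simp add: reach_Suc algebra_simps)
  qed (simp add: U_N)
  obtain d where d: "1 < real d * c" using c reals_Archimedean3 by blast
  \<comment> \<open>Large enough to lie beyond L5, where the tail bound is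
    \<open>\<delta> + U B \<ge> 1\<close>, and for the growing ratio bound to exceed 1.\<close>
  define k where "k = N + d + L"
  have "real d * c \<le> real (d + L + 1) * c" using c by (intro mult_right_mono) auto
  then have "1 < reach P U (Suc k)"
    using grow[of "d + L + 1"] d U_nonneg[of N] by (simp add: k_def add_ac)
  moreover have "U (Suc k) = min (\<delta> + U B) (reach P U (Suc k))"
    using U_late[of k] I_less_L by (simp add: k_def)
  ultimately have "1 \<le> U (Suc k)" using U_B by simp
  then show False using less[of "Suc k"] by (simp add: k_def)
qed

text \<open>The loop test \<open>rest \<le> m\<close> at \<open>Suc k\<close> says
  \<open>1 \<le> U (Suc k)\<close>, so the loop follows \<open>run\<close> up to the first
  \<open>K\<close> after \<open>N\<close> with \<open>1 \<le> U K\<close>.\<close>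

lemma late_loop_run:
  assumes "N \<le> k" "k < K" "\<And>j. k < j \<Longrightarrow> j < K \<Longrightarrow> U j < 1" "1 \<le> U K"
  shows "late_loop a \<gamma> \<delta> \<tau> P (Suc k) (run P k) = Some ((run P (K - 1))(enat K := 1 - U (K - 1)))"
  using assms
proof (induction "K - k" arbitrary: k rule: less_induct)
  case less
  have rest: "1 - (\<Sum>j\<in>{1..<Suc k}. run P k (enat j)) = 1 - U k"
    by (simp only: atLeastLessThanSuc_atLeastAtMost sum_run order_refl)
  define m where "m = late_cap a \<gamma> \<delta> \<tau> P (run P k) (Suc k)"
  have run: "run P (Suc k) = (run P k)(enat (Suc k) := m)"
    using less.prems(1) by (simp add: m_def)
  have m: "m = U (Suc k) - U k" unfolding run_cum_Suc run by simp
  have loop: "late_loop a \<gamma> \<delta> \<tau> P (Suc k) (run P k) =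
      (if 1 - U k \<le> m then Some ((run P k)(enat (Suc k) := 1 - U k))
       else late_loop a \<gamma> \<delta> \<tau> P (Suc (Suc k)) (run P (Suc k)))"
    by (subst late_loop.simps) (simp only: Let_def rest run m_def[symmetric])
  show ?case
  proof (cases "Suc k = K")
    case True
    then show ?thesis using loop m less.prems(4) by auto
  next
    case False
    then have "Suc k < K" using less.prems(2) by simp
    then have "\<not> 1 - U k \<le> m" using less.prems(3)[of "Suc k"] m by simp
    then show ?thesis
      using loop less.hyps[of "Suc k"] less.prems \<open>Suc k < K\<close> by simp
  qed
qed

text \<open>The last mass, \<open>1 - U (K - 1)\<close>, amounts to replacing \<open>U\<close> by
  \<open>min (U k) 1\<close>. The cut keeps the tail constraints, and the ratio constraints after
  \<open>K\<close> hold because \<open>kappa P \<le> 1\<close>.\<close>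

lemma ex_pmf_loop:
  assumes "N < K" "\<And>j. N < j \<Longrightarrow> j < K \<Longrightarrow> U j < 1" "1 \<le> U K"
  shows "\<exists>f. pmf f = (run P (K - 1))(enat K := 1 - U (K - 1)) \<and>
    feasible a \<gamma> \<delta> \<tau> f \<and> worst_ratio a \<tau> f \<le> ennreal P"
proof -
  define V where "V k = min (U k) 1" for k
  have early: "V k = U k" if "k < K" for k
    using that assms(2)[of k] U_le_1_early[of k] by (cases "k \<le> N") (auto simp: V_def)
  have late: "V k = 1" if "K \<le> k" for k
    using that assms(3) monoD[OF U_mono that] by (simp add: V_def)
  have reach_eq: "reach P V k = reach P U k" if "k \<le> K" for k
    using that early by (simp add: reach_def)
  have ratio: "V k \<le> reach P V k" if "k \<le> K" for k
    using that U_le_reach[of k] by (simp add: reach_eq) (simp add: V_def)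
  have "\<exists>f. (\<forall>j. pmf f (enat j) = V j - V (j - 1)) \<and> pmf f \<infinity> = 1 - V K \<and>
      feasible a \<gamma> \<delta> \<tau> f \<and> worst_ratio a \<tau> f \<le> ennreal P"
  proof (rule feasible_of_cum)
    show "mono V" using U_mono by (auto simp: V_def mono_def intro: min.coboundedI1)
    show "V k = V K" if "K \<le> k" for k using that late by simp
    show "V k \<le> reach P V k" for k
    proof (cases "k \<le> K")
      case False
      then have "1 \<le> reach P V k"
        using reach_ge_const[of K V 1 P k] late ratio[of K] kappa_le_1[OF P_ge_1] assms(1) by simp
      then show ?thesis using False late by simp
    qed (rule ratio)
    show "V k \<le> \<delta> + V (min (low k) k)" if "0 < k" "k \<le> L" for k
      using U_tail[OF that] delta_nonneg by (auto simp: V_def min_def)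
    show "1 - V B \<le> \<delta>" using U_B delta_nonneg by (auto simp: V_def min_def)
    show "(1 - V K) * (1 - a) \<le> a * (P - 1)"
      using late[of K] a_nonneg P_ge_1 by simp
  qed (use P_ge_1 in \<open>auto simp: V_def\<close>)
  then obtain f where f: "\<forall>j. pmf f (enat j) = V j - V (j - 1)" "pmf f \<infinity> = 1 - V K"
    "feasible a \<gamma> \<delta> \<tau> f" "worst_ratio a \<tau> f \<le> ennreal P" by blast
  have "pmf f t = ((run P (K - 1))(enat K := 1 - U (K - 1))) t" for t
  proof (cases t)
    case (enat j)
    consider "j < K" | "j = K" | "K < j" by linarith
    then show ?thesis
    proof cases
      case 1
      then have "V j = U j" "V (j - 1) = U (j - 1)" "j \<le> K - 1" by (auto intro: early)
      then show ?thesis using 1 enat f(1) by (simp add: run_eq_diff)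
    next
      case 2
      then show ?thesis using enat f(1) early[of "K - 1"] late[of K] assms(1) by simp
    next
      case 3
      then have "V j = 1" "V (j - 1) = 1" by (auto intro: late)
      then show ?thesis using 3 enat f(1) by (simp add: run_outside)
    qed
  next
    case infinity
    then show ?thesis using f(2) late[of K] by (simp add: run_infinity)
  qed
  with f show ?thesis by (intro exI[of _ f]) auto
qed

text \<open>The test says that without mass at \<open>1 + \<tau>\<close> the ratio there is exactly
  \<open>P\<close>, that is, the ratio bound does not change from \<open>N\<close> to
  \<open>Suc N\<close>; its change is \<open>\<tau> * (U N - kappa P)\<close>.\<close>

lemma step_iv_iff:
  "P = (1 + \<tau>) / (1 - a + a * (1 + \<tau>)) +
      (\<Sum>j\<in>{1..N}. (1 - a) * (real j * \<tau> - \<tau>) / (1 - a + a * (1 + \<tau>)) * run P N (enat j))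
    \<longleftrightarrow> U N = kappa P"
proof -
  define D where "D = 1 - a + a * (1 + \<tau>)"
  define S where "S = U N - \<tau> * (\<Sum>i<Suc N. U i)"
  have D: "0 < D" using a_less_1 a_nonneg tau_pos by (simp add: D_def add_pos_nonneg)
  have t: "real (Suc N) * \<tau> = 1 + \<tau>" using N_tau by (simp add: algebra_simps)
  have "(\<Sum>j\<in>{1..N}. (real j * \<tau> - \<tau>) * run P N (enat j)) = earlier \<tau> (run P N) (Suc N)"
    unfolding earlier_def t atLeastLessThanSuc_atLeastAtMost by (intro sum.cong) auto
  also have "\<dots> = S" by (simp only: earlier_run S_def)
  finally have "(\<Sum>j\<in>{1..N}. (1 - a) * (real j * \<tau> - \<tau>) / D * run P N (enat j)) = (1 - a) * S / D"
    by (simp add: mult.assoc flip: sum_distrib_left sum_divide_distrib)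
  then have "P = (1 + \<tau>) / D + (\<Sum>j\<in>{1..N}. (1 - a) * (real j * \<tau> - \<tau>) / D * run P N (enat j))
      \<longleftrightarrow> P = (1 + \<tau> + (1 - a) * S) / D"
    by (simp only: add_divide_distrib)
  also have "\<dots> \<longleftrightarrow> P * D = 1 + \<tau> + (1 - a) * S" using D by (simp add: eq_divide_eq)
  also have "\<dots> \<longleftrightarrow> S * (1 - a) = D * P - (1 + \<tau>)" by (auto simp: algebra_simps)
  also have "\<dots> \<longleftrightarrow> S = (D * P - (1 + \<tau>)) / (1 - a)" using a_less_1 by (simp add: eq_divide_eq)
  also have "(D * P - (1 + \<tau>)) / (1 - a) = cap P (Suc N)"
    unfolding cap_def t D_def by simp
  also have "S = cap P (Suc N) \<longleftrightarrow> U N = reach P U (Suc N)"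
    by (auto simp: S_def reach_def)
  also have "\<dots> \<longleftrightarrow> U N = kappa P" using tau_pos by (simp add: reach_Suc flip: U_N)
  finally show ?thesis unfolding D_def .
qed

lemma greedy_optimal:
  "\<exists>f. greedy a \<gamma> \<delta> \<tau> P = Some (pmf f) \<and> feasible a \<gamma> \<delta> \<tau> f \<and> worst_ratio a \<tau> f = ennreal P"
proof -
  have "1 / \<tau> = real N" using N_tau tau_pos by (simp add: field_simps)
  then have "nat \<lfloor>1 / \<tau>\<rfloor> = N" by simp
  then have greedy: "greedy a \<gamma> \<delta> \<tau> P =
      (if U N = kappa P then Some ((run P N)(\<infinity> := (if a = 0 then 0 else (P - 1) / (1 / a - 1))))
       else late_loop a \<gamma> \<delta> \<tau> P (Suc N) (run P N))"
    by (simp only: greedy_def Let_def head_eq_run[OF order_refl] step_iv_iff Suc_eq_plus1)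
  have "\<exists>f. greedy a \<gamma> \<delta> \<tau> P = Some (pmf f) \<and> feasible a \<gamma> \<delta> \<tau> f \<and> worst_ratio a \<tau> f \<le> ennreal P"
  proof (cases "U N = kappa P")
    case True
    have "(if a = 0 then 0 else (P - 1) / (1 / a - 1)) = 1 - kappa P"
    proof (cases "a = 0")
      case True
      then have "kappa P = 1" unfolding kappa_def by simp
      then show ?thesis using True by simp
    next
      case False
      then have "1 / a - 1 = (1 - a) / a" by (simp add: field_simps)
      moreover have "1 - kappa P = a * (P - 1) / (1 - a)"
        using a_less_1 by (simp add: kappa_def divide_simps) (simp add: algebra_simps)
      ultimately show ?thesis using False by simp
    qed
    then have "greedy a \<gamma> \<delta> \<tau> P = Some ((run P N)(\<infinity> := 1 - kappa P))"
      using True by (simp add: greedy)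
    then show ?thesis using ex_pmf_kappa[OF True] by metis
  next
    case False
    then have "\<exists>k. N < k \<and> 1 \<le> U k" using ex_U_ge_1 kappa_le_U_N by force
    then have "\<exists>K. (N < K \<and> 1 \<le> U K) \<and> (\<forall>j<K. \<not> (N < j \<and> 1 \<le> U j))"
      by (subst (asm) exists_least_iff)
    then obtain K where K: "N < K" "1 \<le> U K" "\<And>j. j < K \<Longrightarrow> \<not> (N < j \<and> 1 \<le> U j)"
      by blast
    then have less: "U j < 1" if "N < j" "j < K" for j using that by force
    have "greedy a \<gamma> \<delta> \<tau> P = Some ((run P (K - 1))(enat K := 1 - U (K - 1)))"
      using late_loop_run[OF order_refl K(1) less K(2)] False by (simp add: greedy)
    then show ?thesis using ex_pmf_loop[OF K(1) less K(2)] by metis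
  qed
  then show ?thesis using minimal by (blast intro: antisym)
qed

end

section \<open>The optimal value and the choice of the step\<close>

lemma (in ski_grid) opt_value_finite:
  obtains P where "opt_value a \<gamma> \<delta> \<tau> = ennreal P" "1 \<le> P" "P \<le> \<gamma>"
proof -
  let ?o = "opt_value a \<gamma> \<delta> \<tau>"
  have ge: "1 \<le> ?o"
    unfolding opt_value_def by (intro INF_greatest one_le_worst_ratio)
  obtain f where "feasible a \<gamma> \<delta> \<tau> f" "worst_ratio a \<tau> f \<le> ennreal \<gamma>"
    using ex_feasible_gamma by blast
  then have le: "?o \<le> ennreal \<gamma>"
    unfolding opt_value_def by (intro INF_lower2[of f]) auto
  then have "?o < \<top>" using le_less_trans ennreal_less_top by blast
  then obtain P where P: "?o = ennreal P" "0 \<le> P"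
    by (cases ?o) auto
  then show thesis
    using ge le gamma_gt_1 that[of P] by (auto simp: ennreal_le_iff simp flip: ennreal_1)
qed

lemma (in ski_grid) ski_greedyI:
  assumes P: "opt_value a \<gamma> \<delta> \<tau> = ennreal P" "1 \<le> P" and "1 < M"
    and "run_cum P M = reach P (run_cum P) M"
  shows "ski_greedy a \<gamma> \<delta> \<tau> M N I L B P"
proof unfold_locales
  fix \<epsilon> :: real assume "0 < \<epsilon>"
  then have "opt_value a \<gamma> \<delta> \<tau> < ennreal (P + \<epsilon>)"
    using P by (simp add: ennreal_less_iff)
  then show "\<exists>g. feasible a \<gamma> \<delta> \<tau> g \<and> worst_ratio a \<tau> g \<le> ennreal (P + \<epsilon>)"
    unfolding opt_value_def INF_less_iff by (auto intro: less_imp_le)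
next
  fix g assume "feasible a \<gamma> \<delta> \<tau> g"
  then show "ennreal P \<le> worst_ratio a \<tau> g"
    unfolding P(1)[symmetric] opt_value_def by (intro INF_lower) auto
qed (use assms in auto)

theorem theorem1:
  fixes a \<gamma> \<delta> :: real
  assumes "0 \<le> a" and "a < 1"
    and "2 - a \<le> \<gamma>" and "a > 0 \<longrightarrow> \<gamma> < 1 / a"
    and "0 \<le> \<delta>" and "\<delta> \<le> 1"
  shows "\<exists>\<tau>0>0. \<forall>\<tau>. valid_step a \<gamma> \<tau> \<and> \<tau> < \<tau>0 \<longrightarrow>
           (\<exists>f :: enat pmf.
              greedy a \<gamma> \<delta> \<tau> (enn2real (opt_value a \<gamma> \<delta> \<tau>)) = Some (pmf f) \<and>
              optimal_solution a \<gamma> \<delta> \<tau> f)"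
proof -
  define q where "q = (\<gamma> - 1) / (1 - a)"
  have q: "1 \<le> q" using assms by (simp add: q_def)
  have l3: "0 < L3 a \<gamma>" using assms by (simp add: L3_def)
  have ag: "a * \<gamma> < 1" using assms by (cases "a = 0") (auto simp: field_simps)
  obtain Q :: nat where Q: "1 + q \<le> real Q" using real_arch_simple by blast
  have Q1: "1 \<le> Q" using Q q by linarith
  obtain n :: nat where n: "0 < \<delta> \<longrightarrow> 2 * q < real n * \<delta>"
    using reals_Archimedean3 by (cases "0 < \<delta>") blast+
  \<comment> \<open>The first bound gives \<open>Q ^ n < M\<close>, the second keeps the drop of the
    ratio bound over \<open>Q ^ n\<close> steps at most \<open>\<delta>\<close>. For
    \<open>\<delta> = 0\<close> no tail cap is imposed at L3, and only \<open>1 < M\<close> has to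
    be ensured.\<close>
  define \<tau>0 where "\<tau>0 = (if 0 < \<delta> then min (L3 a \<gamma> / real (Q ^ n)) (\<delta> / (real (Q ^ n) * (3 * q)))
    else L3 a \<gamma>)"
  have Qn: "0 < real (Q ^ n)" using Q1 by simp
  show ?thesis
  proof (intro exI[of _ \<tau>0] conjI allI impI)
    show "0 < \<tau>0" using l3 Qn q by (auto simp: \<tau>0_def)
    fix \<tau> assume "valid_step a \<gamma> \<tau> \<and> \<tau> < \<tau>0"
    then have vs: "valid_step a \<gamma> \<tau>" and small: "\<tau> < \<tau>0" by auto
    from vs obtain M N I L B where grid: "ski_grid a \<gamma> \<delta> \<tau> M N I L B"
      unfolding valid_step_def on_grid_def ski_grid_def using assms ag by metis
    interpret ski_grid a \<gamma> \<delta> \<tau> M N I L B by (rule grid)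
    obtain P where P: "opt_value a \<gamma> \<delta> \<tau> = ennreal P" "1 \<le> P" "P \<le> \<gamma>"
      by (rule opt_value_finite)
    have "1 < M \<and> run_cum P M = reach P (run_cum P) M"
    proof (cases "0 < \<delta>")
      case True
      then have s: "\<tau> < L3 a \<gamma> / real (Q ^ n)" "\<tau> < \<delta> / (real (Q ^ n) * (3 * q))"
        using small by (auto simp: \<tau>0_def)
      have "real (Q ^ n) * \<tau> < real M * \<tau>"
        using s(1) Qn unfolding M_tau by (simp only: pos_less_divide_eq mult.commute)
      then have QM: "Q ^ n < M" by (simp only: time_less_iff)
      moreover have "1 \<le> Q ^ n" using Q1 by simp
      ultimately have "1 < M" by linarith
      have "0 < real (Q ^ n) * (3 * q)" using Qn q by (intro mult_pos_pos) auto
      then have "real (Q ^ n) * \<tau> * (3 * q) \<le> \<delta>"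
        using s(2) by (simp only: pos_less_divide_eq) (simp add: mult_ac)
      then show ?thesis
        using run_cum_M[of P Q n] P Q n True QM \<open>1 < M\<close> unfolding q_def by simp
    next
      case False
      then have "real 1 * \<tau> < real M * \<tau>" using small M_tau by (simp add: \<tau>0_def)
      then have "1 < M" by (simp only: time_less_iff)
      moreover have "run_cum P M = reach P (run_cum P) M"
        using run_cum_head[of "M - 1" P] \<open>1 < M\<close> M_le_N False by simp
      ultimately show ?thesis by simp
    qed
    then interpret ski_greedy a \<gamma> \<delta> \<tau> M N I L B P
      using ski_greedyI P by blast
    show "\<exists>f :: enat pmf.
        greedy a \<gamma> \<delta> \<tau> (enn2real (opt_value a \<gamma> \<delta> \<tau>)) = Some (pmf f) \<and>
        optimal_solution a \<gamma> \<delta> \<tau> f"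
      using greedy_optimal P by (simp add: optimal_solution_def)
  qed
qed

end
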